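(* Let $f:\mathbb{R}^d\to\mathbb{R}$ be $L_0$-Lipschitz continuous and $L$-smooth (not necessarily convex), with minimum value $f(x^* )>-\infty$. Run the deterministic one-point residual feedback algorithm from $x_1$ for $T$ iterations with $$\eta=\frac{\alpha}{4dL_0},\qquad \alpha=\left(\frac{dL_0(f(x_1)-f(x^* ))}{L^2T}\right)^{1/3}.$$ Suppose that $$T\ge\max\left\{\frac{6^{3/2}dL_0}{(f(x_1)-f(x^* ))^{1/2}L^{1/2}},\ \frac{5^3\,d^4(f(x_1)-f(x^* ))}{L^2L_0^2},\ \frac{4^3\,Ld^4(f(x_1)-f(x^* ))}{L_0^2}\right\}.$$ Let $\varepsilon>0$. Then, to achieve $$\frac1T\sum_{t=1}^T\mathbb{E}\big[\|\nabla f(x_t)\|^2\big]\le\varepsilon^2,$$ the sample complexity of the algorithm is $$T=\frac{24^{3/2}\,dL_0L\,(f(x_1)-f(x^* ))}{\varepsilon^3},$$ that is, the displayed inequality holds whenever $T$ satisfies the condition above and is at least this quantity.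
   Context: $\|\cdot\|$ is the Euclidean norm on $\mathbb{R}^d$, $d\ge1$. A function $f$ is $L_0$-Lipschitz continuous ($L_0>0$) if $|f(x)-f(y)|\le L_0\|x-y\|$ for all $x,y$; it is $L$-smooth ($L>0$) if it is differentiable and $\|\nabla f(x)-\nabla f(y)\|\le L\|x-y\|$ for all $x,y$. $x^*$ denotes a minimizer of $f$ over $\mathbb{R}^d$. Deterministic one-point residual feedback algorithm: given an initial point $x_1\in\mathbb{R}^d$, step size $\eta>0$, smoothing parameter $\alpha>0$ and iteration number $T$, set $x_0=x_1$, let $u_0,u_1,\dots,u_T$ be independent and uniformly distributed on the unit sphere of $\mathbb{R}^d$, and for $t=1,\dots,T$ put $$g_t=d\cdot\frac{f(x_t+\alpha u_t)-f(x_{t-1}+\alpha u_{t-1})}{\alpha}\,u_t,\qquad x_{t+1}=x_t-\eta g_t .$$ Each iteration uses one new function evaluation, so the number of iterations is the sample complexity. Expectations are over all the $u_t$. *)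

theory Defs
  imports "HOL-Probability.Probability"
begin

definition gradient :: "('a::euclidean_space \<Rightarrow> real) \<Rightarrow> 'a \<Rightarrow> 'a" where
  "gradient f x = (THE D. GDERIV f x :> D)"

lemma gradient_eqI:
  assumes "GDERIV f x :> D"
  shows "gradient f x = D"
  unfolding gradient_def
proof (rule the_equality)
  show "GDERIV f x :> D" by (fact assms)
next
  fix D' assume "GDERIV f x :> D'"
  then have "(\<lambda>h. h \<bullet> D') = (\<lambda>h. h \<bullet> D)"
    using assms unfolding gderiv_def by (rule has_derivative_unique)
  then have "h \<bullet> D' = h \<bullet> D" for h
    by metis
  then show "D' = D"
    by (meson vector_eq_ldot)
qed

lemma GDERIV_gradient:
  fixes f :: "'a::euclidean_space \<Rightarrow> real"
  assumes "f differentiable (at x)"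
  shows "GDERIV f x :> gradient f x"
proof -
  obtain f' where f': "(f has_derivative f') (at x)"
    using assms unfolding differentiable_def by blast
  then interpret linear f'
    by (rule has_derivative_linear)
  have "f' h = h \<bullet> (\<Sum>b\<in>Basis. f' b *\<^sub>R b)" for h
  proof -
    have "f' h = f' (\<Sum>b\<in>Basis. (h \<bullet> b) *\<^sub>R b)"
      by (simp add: euclidean_representation)
    also have "\<dots> = h \<bullet> (\<Sum>b\<in>Basis. f' b *\<^sub>R b)"
      by (simp add: sum scale inner_sum_right mult.commute)
    finally show ?thesis .
  qed
  then have "f' = (\<lambda>h. h \<bullet> (\<Sum>b\<in>Basis. f' b *\<^sub>R b))"
    by blast
  with f' have "GDERIV f x :> (\<Sum>b\<in>Basis. f' b *\<^sub>R b)"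
    unfolding gderiv_def by metis
  then show ?thesis
    using gradient_eqI by metis
qed

definition smooth_with :: "real \<Rightarrow> ('a::euclidean_space \<Rightarrow> real) \<Rightarrow> bool" where
  "smooth_with L f \<longleftrightarrow>
     (\<forall>x. f differentiable (at x)) \<and>
     (\<forall>x y. norm (gradient f x - gradient f y) \<le> L * norm (x - y))"

(* The normalized surface measure of the unit sphere, obtained as the radial projection of the
   uniform distribution on the unit ball. The centre of the ball, which is sent to 0, is a null set.
   In dimension one this gives mass 1/2 to each of the two unit vectors. *)
definition uniform_sphere :: "'a::euclidean_space measure" where
  "uniform_sphere = distr (uniform_measure lborel (ball 0 1)) borel (\<lambda>v. v /\<^sub>R norm v)"

lemma sets_uniform_sphere [simp]: "sets uniform_sphere = sets borel"
  by (simp add: uniform_sphere_def)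

lemma emeasure_unit_ball:
  "emeasure lborel (ball (0::'a::euclidean_space) 1) \<noteq> 0"
  "emeasure lborel (ball (0::'a::euclidean_space) 1) \<noteq> \<infinity>"
proof -
  show "emeasure lborel (ball (0::'a) 1) \<noteq> 0"
    using open_not_negligible[of "ball (0::'a) 1"]
    by (auto simp: negligible_iff_null_sets null_sets_def)
  show "emeasure lborel (ball (0::'a) 1) \<noteq> \<infinity>"
    using emeasure_bounded_finite[of "ball (0::'a) 1"] by auto
qed

lemma prob_space_uniform_sphere: "prob_space (uniform_sphere :: 'a::euclidean_space measure)"
  unfolding uniform_sphere_def
  by (intro prob_space.prob_space_distr prob_space_uniform_measure emeasure_unit_ball)
     (auto simp: measurable_def[symmetric])

lemma AE_uniform_sphere: "AE v in (uniform_sphere :: 'a::euclidean_space measure). norm v = 1"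
proof -
  have "AE v in lborel. v \<noteq> (0::'a)"
    by (rule AE_lborel_singleton)
  then have "AE v in uniform_measure lborel (ball (0::'a) 1). norm (v /\<^sub>R norm v) = 1"
    by (intro AE_uniform_measureI) auto
  then show ?thesis
    unfolding uniform_sphere_def by (subst AE_distr_iff) auto
qed

(* The iterates of the residual feedback algorithm for one realization u 0, u 1, ... of the
   random directions: u t is the direction drawn at step t. The iterate with index Suc 0 is the
   initial point x1, and so is the one with index 0. *)
fun residual_iterate ::
  "('a::euclidean_space \<Rightarrow> real) \<Rightarrow> real \<Rightarrow> real \<Rightarrow> 'a \<Rightarrow> (nat \<Rightarrow> 'a) \<Rightarrow> nat \<Rightarrow> 'a" where
  "residual_iterate f \<eta> \<alpha> x1 u 0 = x1"
| "residual_iterate f \<eta> \<alpha> x1 u (Suc 0) = x1"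
| "residual_iterate f \<eta> \<alpha> x1 u (Suc (Suc t)) =
    (let x = residual_iterate f \<eta> \<alpha> x1 u (Suc t);
         x' = residual_iterate f \<eta> \<alpha> x1 u t;
         g = (real DIM('a) * ((f (x + \<alpha> *\<^sub>R u (Suc t)) - f (x' + \<alpha> *\<^sub>R u t)) / \<alpha>)) *\<^sub>R u (Suc t)
     in x - \<eta> *\<^sub>R g)"

end

theory Submission
  imports Defs
begin

text \<open>
  Write \<open>N\<close> for the mean squared gradient norm and \<open>\<delta>\<close> for the mean squared residual, that is, the
  difference of consecutive function values, at a given step; \<open>d\<close> is the dimension. The proof
  couples two inequalities.

  Descent: by smoothness, one step changes \<open>f\<close> by an inner product of the gradient with the estimator
  plus a multiple of the squared residual. The newest direction is independent of everything else in
  the step, so averaging over it first replaces the estimator by its mean, which differs from the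
  gradient, in the direction of the gradient, by at most \<open>L * \<alpha>\<close>
  (\<open>one_point_estimate_lower_bound\<close>). Hence in expectation \<open>f\<close> falls by a
  multiple of \<open>N - L\<^sup>2 * \<alpha>\<^sup>2\<close>, up to a multiple of \<open>\<delta>\<close> (\<open>mean_descent\<close>).

  Residuals: a residual consists of a part of order \<open>L * \<alpha>\<^sup>2\<close>, a part that is at most a quarter of
  the previous residual, by the Lipschitz condition and the choice of \<open>\<eta>\<close>, and the slopes of \<open>f\<close>
  along two random directions. The slopes have second moment \<open>N / d\<close>, so \<open>\<delta>\<close> obeys a contracting
  recursion driven by \<open>L\<^sup>2 * \<alpha> ^ 4\<close> and \<open>\<alpha>\<^sup>2 * N / d\<close> (\<open>mean_residual_recursion\<close>).

  Summing both and inserting the second into the first, the gradient terms that come from the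
  residuals are a small fraction of those gained by descent as soon as \<open>4 * d * L * \<alpha> \<le> L0\<close>. What remains is a
  multiple of \<open>T * L\<^sup>2 * \<alpha>\<^sup>2\<close> (\<open>sum_mean_square_gradient_le\<close>), because the choice of \<open>\<alpha>\<close> makes the
  contribution of the initial gap equal to \<open>8 * T * L\<^sup>2 * \<alpha>\<^sup>2\<close>. In terms of \<open>\<alpha>\<close>, the prescribed sample complexity is
  \<open>24 * L\<^sup>2 * \<alpha>\<^sup>2 \<le> \<epsilon>\<^sup>2\<close>.

  Both facts about the sphere that enter, the bias estimate and the second moment of a linear form,
  rest on its invariance under reflections. That in turn is the invariance of Lebesgue measure
  under orthogonal maps of an arbitrary Euclidean space
  (\<open>lborel_distr_orthogonal_transformation\<close>), which is derived from translation invariance.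
\<close>

section \<open>Lebesgue measure and the sphere under orthogonal maps\<close>

lemma ennreal_mult_right_cancel:
  fixes a b c :: ennreal
  assumes "c \<noteq> 0" "c \<noteq> top"
  shows "a * c = b * c \<longleftrightarrow> a = b"
  using ennreal_mult_le_mult_iff[OF assms] by (metis mult.commute order_antisym_conv order_refl)

lemma nn_integral_lborel_translate:
  fixes h :: "'a::euclidean_space \<Rightarrow> ennreal"
  assumes [measurable]: "h \<in> borel_measurable borel"
  shows "(\<integral>\<^sup>+x. h (c + x) \<partial>lborel) = (\<integral>\<^sup>+x. h x \<partial>lborel)"
proof -
  have "(\<integral>\<^sup>+x. h x \<partial>lborel) = (\<integral>\<^sup>+x. h x \<partial>distr lborel borel ((+) c))"
    by (simp only: lborel_distr_plus)
  also have "\<dots> = (\<integral>\<^sup>+x. h (c + x) \<partial>lborel)"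
    by (subst nn_integral_distr) auto
  finally show ?thesis by simp
qed

lemma borel_measurable_orthogonal_transformation:
  fixes R :: "'a::euclidean_space \<Rightarrow> 'a"
  assumes "orthogonal_transformation R"
  shows "R \<in> borel_measurable borel"
  using assms by (intro borel_measurable_continuous_onI linear_continuous_on)
    (simp add: orthogonal_transformation_def linear_conv_bounded_linear)

text \<open>
  This is the uniqueness argument for Haar measure. The image of Lebesgue measure under \<open>R\<close> is
  again translation invariant, and for two translation invariant measures \<open>\<mu>\<close> and \<open>\<nu>\<close> three shifts and
  Fubini give \<open>\<mu> A * \<nu> B = \<nu> A * \<mu> (- B)\<close>. The unit ball \<open>B\<close> is symmetric and has the same finite positive
  measure under both, because \<open>R\<close> preserves it. All integrals below are taken over Lebesgue measure,
  with \<open>R\<close> inside the integrand.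
\<close>

lemma lborel_distr_orthogonal_transformation:
  fixes R :: "'a::euclidean_space \<Rightarrow> 'a"
  assumes "orthogonal_transformation R"
  shows "distr lborel borel R = lborel"
proof (rule measure_eqI)
  have lin: "linear R" and nrm: "\<And>x. norm (R x) = norm x"
    using assms by (auto simp: orthogonal_transformation)
  have [measurable]: "R \<in> borel_measurable borel"
    by (rule borel_measurable_orthogonal_transformation[OF assms])
  fix A :: "'a set" assume "A \<in> sets (distr lborel borel R)"
  then have [measurable]: "A \<in> sets borel" by simp
  define B where "B = ball (0::'a) 1"
  have [measurable]: "B \<in> sets borel" by (simp add: B_def)
  define R' where "R' = inv R"
  have R': "R (R' y) = y" for y
    unfolding R'_def by (rule surj_f_inv_f[OF orthogonal_transformation_surj[OF assms]])
  have shift1: "(\<integral>\<^sup>+x. indicator A (R x) * indicator B y \<partial>lborel)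
      = (\<integral>\<^sup>+x. indicator A (R x + y) * indicator B y \<partial>lborel)" for y
    using nn_integral_lborel_translate[of "\<lambda>x. indicator A (R x) * indicator B y" "R' y"]
    by (simp add: linear_add[OF lin] R' add.commute)
  have shift2: "(\<integral>\<^sup>+y. indicator A (R x + y) * indicator B y \<partial>lborel)
      = (\<integral>\<^sup>+y. indicator A y * indicator B (y - R x) \<partial>lborel)" for x
    using nn_integral_lborel_translate[of "\<lambda>y. indicator A y * indicator B (y - R x)" "R x"]
    by simp
  have shift3: "(\<integral>\<^sup>+x. indicator A y * indicator B (y - R x) \<partial>lborel)
      = (\<integral>\<^sup>+x. indicator A y * indicator B x \<partial>lborel)" for y
  proof -
    have "indicator B (y - R (R' y + x)) = (indicator B x :: ennreal)" for x
      by (simp add: linear_add[OF lin] R' B_def indicator_def nrm)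
    then show ?thesis
      using nn_integral_lborel_translate[of "\<lambda>x. indicator A y * indicator B (y - R x)" "R' y"]
      by simp
  qed
  have "emeasure (distr lborel borel R) A = (\<integral>\<^sup>+x. indicator A x \<partial>distr lborel borel R)"
    by simp
  also have "\<dots> = (\<integral>\<^sup>+x. indicator A (R x) \<partial>lborel)"
    by (rule nn_integral_distr) auto
  finally have "emeasure (distr lborel borel R) A * emeasure lborel B
      = (\<integral>\<^sup>+x. indicator A (R x) \<partial>lborel) * (\<integral>\<^sup>+y. indicator B y \<partial>lborel)"
    by simp
  also have "\<dots> = (\<integral>\<^sup>+y. (\<integral>\<^sup>+x. indicator A (R x) * indicator B y \<partial>lborel) \<partial>lborel)"
    by (simp add: nn_integral_multc nn_integral_cmult)
  also have "\<dots> = (\<integral>\<^sup>+y. (\<integral>\<^sup>+x. indicator A (R x + y) * indicator B y \<partial>lborel) \<partial>lborel)"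
    by (simp only: shift1)
  also have "\<dots> = (\<integral>\<^sup>+x. (\<integral>\<^sup>+y. indicator A (R x + y) * indicator B y \<partial>lborel) \<partial>lborel)"
    by (rule lborel_pair.Fubini') measurable
  also have "\<dots> = (\<integral>\<^sup>+x. (\<integral>\<^sup>+y. indicator A y * indicator B (y - R x) \<partial>lborel) \<partial>lborel)"
    by (simp only: shift2)
  also have "\<dots> = (\<integral>\<^sup>+y. (\<integral>\<^sup>+x. indicator A y * indicator B (y - R x) \<partial>lborel) \<partial>lborel)"
    by (rule lborel_pair.Fubini') measurable
  also have "\<dots> = emeasure lborel A * emeasure lborel B"
    by (simp add: shift3 nn_integral_multc nn_integral_cmult)
  finally show "emeasure (distr lborel borel R) A = emeasure lborel A"
    using emeasure_unit_ball[where 'a='a]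
    by (simp add: B_def infinity_ennreal_def ennreal_mult_right_cancel)
qed simp

lemma uniform_sphere_distr_orthogonal_transformation:
  fixes R :: "'a::euclidean_space \<Rightarrow> 'a"
  assumes "orthogonal_transformation R"
  shows "distr uniform_sphere borel R = uniform_sphere"
proof -
  have lin: "linear R" and nrm: "\<And>x. norm (R x) = norm x"
    using assms by (auto simp: orthogonal_transformation)
  have [measurable]: "R \<in> borel_measurable borel"
    by (rule borel_measurable_orthogonal_transformation[OF assms])
  have ball: "distr (uniform_measure lborel (ball 0 1)) borel R
      = (uniform_measure lborel (ball 0 1) :: 'a measure)"
  proof (rule measure_eqI)
    fix A :: "'a set" assume "A \<in> sets (distr (uniform_measure lborel (ball 0 1)) borel R)"
    then have [measurable]: "A \<in> sets borel" by simp
    have "emeasure lborel (ball 0 1 \<inter> R -` A) = emeasure (distr lborel borel R) (ball 0 1 \<inter> A)"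
      by (subst emeasure_distr) (auto simp: nrm intro!: arg_cong2[where f=emeasure])
    moreover have "R -` A \<in> sets borel"
      using measurable_sets_borel[of R borel A] by simp
    ultimately show "emeasure (distr (uniform_measure lborel (ball 0 1)) borel R) A
        = emeasure (uniform_measure lborel (ball 0 1)) A"
      by (simp add: emeasure_distr lborel_distr_orthogonal_transformation[OF assms])
  qed simp
  have "distr uniform_sphere borel R
      = distr (uniform_measure lborel (ball 0 1)) borel (R \<circ> (\<lambda>v. v /\<^sub>R norm v))"
    unfolding uniform_sphere_def by (subst distr_distr) auto
  also have "R \<circ> (\<lambda>v. v /\<^sub>R norm v) = (\<lambda>v. v /\<^sub>R norm v) \<circ> R"
    by (auto simp: fun_eq_iff linear_scale[OF lin] nrm)
  also have "distr (uniform_measure lborel (ball 0 1)) borel ((\<lambda>v. v /\<^sub>R norm v) \<circ> R)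
      = distr (distr (uniform_measure lborel (ball 0 1)) borel R) borel (\<lambda>v. v /\<^sub>R norm v)"
    by (subst distr_distr) auto
  finally show ?thesis
    by (simp add: ball uniform_sphere_def)
qed

text \<open>
  The reflection in the hyperplane orthogonal to \<open>v\<close>. For \<open>v = 0\<close> the division by zero makes it the
  identity, which is still orthogonal and leaves the sphere invariant.
\<close>

definition reflect :: "'a::real_inner \<Rightarrow> 'a \<Rightarrow> 'a" where
  "reflect v x = x - (2 * (x \<bullet> v) / (v \<bullet> v)) *\<^sub>R v"

lemma orthogonal_transformation_reflect: "orthogonal_transformation (reflect v)"
  unfolding orthogonal_transformation_def
proof (intro conjI allI)
  show "linear (reflect v)"
    by (rule linearI) (auto simp: reflect_def inner_add_left algebra_simps add_divide_distrib)
  show "reflect v x \<bullet> reflect v y = x \<bullet> y" for x y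
    by (cases "v = 0")
       (auto simp: reflect_def inner_diff_left inner_diff_right inner_commute field_simps)
qed

lemma norm_reflect: "norm (reflect v x) = norm x"
  using orthogonal_transformation_reflect orthogonal_transformation by blast

lemma borel_measurable_reflect [measurable]:
  "reflect (v::'a::euclidean_space) \<in> borel_measurable borel"
  by (rule borel_measurable_orthogonal_transformation[OF orthogonal_transformation_reflect])

lemma inner_reflect_self: "reflect w x \<bullet> w = - (x \<bullet> w)"
  by (cases "w = 0") (auto simp: reflect_def inner_diff_left)

lemma reflect_swap:
  assumes "norm v = norm w"
  shows "reflect (v - w) v = w"
proof (cases "v = w")
  case False
  have "v \<bullet> v = w \<bullet> w"
    using assms by (simp add: dot_square_norm)
  then have "2 * (v \<bullet> (v - w)) = (v - w) \<bullet> (v - w)"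
    by (simp add: algebra_simps inner_commute)
  moreover have "(v - w) \<bullet> (v - w) \<noteq> 0"
    using False by simp
  ultimately show ?thesis
    by (simp add: reflect_def)
qed (simp add: reflect_def)

lemma integral_uniform_sphere_reflect:
  fixes h :: "'a::euclidean_space \<Rightarrow> real"
  assumes [measurable]: "h \<in> borel_measurable borel"
  shows "(\<integral>u. h (reflect v u) \<partial>uniform_sphere) = (\<integral>u. h u \<partial>uniform_sphere)"
proof -
  have "(\<integral>u. h u \<partial>uniform_sphere) = (\<integral>u. h u \<partial>distr uniform_sphere borel (reflect v))"
    by (simp only: uniform_sphere_distr_orthogonal_transformation orthogonal_transformation_reflect)
  also have "\<dots> = (\<integral>u. h (reflect v u) \<partial>uniform_sphere)"
    by (rule integral_distr) (auto simp: uniform_sphere_def)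
  finally show ?thesis by simp
qed

lemma integrable_uniform_sphere:
  fixes h :: "'a::euclidean_space \<Rightarrow> real"
  assumes [measurable]: "h \<in> borel_measurable borel" and "\<And>u. norm u = 1 \<Longrightarrow> \<bar>h u\<bar> \<le> C"
  shows "integrable uniform_sphere h"
proof -
  interpret prob_space "uniform_sphere :: 'a measure" by (rule prob_space_uniform_sphere)
  show ?thesis
    by (rule integrable_const_bound[where B=C])
       (use AE_uniform_sphere assms in \<open>auto simp: uniform_sphere_def\<close>)
qed

text \<open>
  Reflections act transitively on vectors of a given length, so the integral depends on \<open>norm w\<close>
  only. For unit vectors its value is found by summing over an orthonormal basis, where the
  integrands add up to \<open>1\<close> on the sphere.
\<close>

lemma integral_uniform_sphere_inner_square:
  fixes w :: "'a::euclidean_space"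
  shows "(\<integral>u. (u \<bullet> w)\<^sup>2 \<partial>uniform_sphere) = (norm w)\<^sup>2 / real DIM('a)"
proof -
  interpret prob_space "uniform_sphere :: 'a measure" by (rule prob_space_uniform_sphere)
  let ?I = "\<lambda>w::'a. \<integral>u. (u \<bullet> w)\<^sup>2 \<partial>uniform_sphere"
  have same: "?I v = ?I w" if "norm v = norm w" for v w
  proof -
    have "(u \<bullet> v)\<^sup>2 = (reflect (v - w) u \<bullet> w)\<^sup>2" for u
      using orthogonal_transformation_reflect[of "v - w"] reflect_swap[OF that]
      by (metis orthogonal_transformation_def)
    then show ?thesis
      using integral_uniform_sphere_reflect[of "\<lambda>u. (u \<bullet> w)\<^sup>2" "v - w"] by simp
  qed
  have int: "integrable uniform_sphere (\<lambda>u::'a. (u \<bullet> b)\<^sup>2)" for b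
  proof (rule integrable_uniform_sphere[where C="(norm b)\<^sup>2"])
    show "\<bar>(u \<bullet> b)\<^sup>2\<bar> \<le> (norm b)\<^sup>2" if "norm u = 1" for u
      using power_mono[OF Cauchy_Schwarz_ineq2[of u b], of 2] that by simp
    show "(\<lambda>u::'a. (u \<bullet> b)\<^sup>2) \<in> borel_measurable borel"
      by measurable
  qed
  have unit: "?I b = 1 / real DIM('a)" if "norm b = 1" for b
  proof -
    have "real DIM('a) * ?I b = (\<Sum>c\<in>(Basis::'a set). ?I b)"
      by simp
    also have "\<dots> = (\<Sum>c\<in>Basis. ?I c)"
      by (intro sum.cong refl same) (simp add: that)
    also have "\<dots> = (\<integral>u. (\<Sum>c\<in>(Basis::'a set). (u \<bullet> c)\<^sup>2) \<partial>uniform_sphere)"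
      using int by (subst Bochner_Integration.integral_sum) auto
    also have "\<dots> = integral\<^sup>L uniform_sphere (\<lambda>u::'a. 1)"
    proof (rule integral_cong_AE)
      show "AE u::'a in uniform_sphere. (\<Sum>c\<in>Basis. (u \<bullet> c)\<^sup>2) = 1"
        using AE_uniform_sphere
      proof eventually_elim
        case (elim u)
        then show ?case
          using euclidean_inner[of u u] by (simp add: power2_eq_square dot_square_norm)
      qed
    qed (auto simp: uniform_sphere_def)
    also have "\<dots> = 1" by (simp add: prob_space)
    finally show ?thesis by (simp add: field_simps)
  qed
  show ?thesis
  proof (cases "w = 0")
    case False
    have "?I w = (\<integral>u. (norm w)\<^sup>2 * (u \<bullet> (w /\<^sub>R norm w))\<^sup>2 \<partial>uniform_sphere)"
      using False by (intro Bochner_Integration.integral_cong) (auto simp: power_mult_distrib field_simps)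
    then show ?thesis
      using False unit[of "w /\<^sub>R norm w"] by simp
  qed simp
qed

section \<open>Smooth and Lipschitz functions\<close>

lemma smooth_with_has_derivative:
  assumes "smooth_with L f"
  shows "(f has_derivative (\<lambda>h. h \<bullet> gradient f x)) (at x within S)"
  using GDERIV_gradient[of f x] assms
  by (auto simp: smooth_with_def gderiv_def intro: has_derivative_at_withinI)

lemma smooth_with_norm_gradient_diff:
  assumes "smooth_with L f"
  shows "norm (gradient f x - gradient f y) \<le> L * norm (x - y)"
  using assms by (auto simp: smooth_with_def)

lemma borel_measurable_gradient:
  assumes "smooth_with L f"
  shows "gradient f \<in> borel_measurable borel"
proof -
  have "(max L 0)-lipschitz_on UNIV (gradient f)"
  proof (rule lipschitz_onI)
    show "dist (gradient f x) (gradient f y) \<le> max L 0 * dist x y" for x y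
      using smooth_with_norm_gradient_diff[OF assms, of x y]
        mult_right_mono[of L "max L 0" "norm (x - y)"]
      by (simp add: dist_norm)
  qed simp
  then show ?thesis
    by (intro borel_measurable_continuous_onI lipschitz_on_continuous_on)
qed

lemma borel_measurable_lipschitz:
  assumes "C-lipschitz_on UNIV f"
  shows "f \<in> borel_measurable borel"
  by (intro borel_measurable_continuous_onI lipschitz_on_continuous_on[OF assms])

lemma smooth_with_DERIV_line:
  assumes "smooth_with L f"
  shows "((\<lambda>s. f (x + s *\<^sub>R v)) has_real_derivative (v \<bullet> gradient f (x + s *\<^sub>R v))) (at s)"
proof -
  have "((\<lambda>s. x + s *\<^sub>R v) has_derivative (\<lambda>h. h *\<^sub>R v)) (at s)"
    by (auto intro!: derivative_eq_intros)
  from has_derivative_compose[OF this smooth_with_has_derivative[OF assms]]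
  show ?thesis
    by (simp add: has_field_derivative_def mult.commute[of _ "v \<bullet> _"])
qed

text \<open>
  The difference quotients of \<open>f\<close> at \<open>x\<close> in the direction of the gradient converge to the squared
  norm of the gradient, while the Lipschitz condition bounds them by \<open>C\<close> times its norm.
\<close>

lemma norm_gradient_le_lipschitz:
  assumes "smooth_with L f" and lip: "C-lipschitz_on UNIV f"
  shows "norm (gradient f x) \<le> C"
proof (cases "gradient f x = 0")
  case True
  then show ?thesis using lipschitz_on_nonneg[OF lip] by simp
next
  case False
  let ?g = "gradient f x"
  have "((\<lambda>h. (f (x + h *\<^sub>R ?g) - f x) / h) \<longlongrightarrow> ?g \<bullet> ?g) (at 0)"
    using smooth_with_DERIV_line[OF assms(1), of x ?g 0] by (simp add: DERIV_def)
  moreover have "\<forall>\<^sub>F h in at 0. (f (x + h *\<^sub>R ?g) - f x) / h \<le> C * norm ?g"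
  proof (rule always_eventually, rule allI)
    fix h :: real
    have "\<bar>f (x + h *\<^sub>R ?g) - f x\<bar> \<le> C * norm ?g * \<bar>h\<bar>"
      using lipschitz_onD[OF lip, of "x + h *\<^sub>R ?g" x] by (simp add: dist_norm mult_ac)
    then have "\<bar>(f (x + h *\<^sub>R ?g) - f x) / h\<bar> \<le> C * norm ?g"
      using lipschitz_on_nonneg[OF lip]
      by (cases "h = 0") (auto simp: abs_divide divide_le_eq)
    then show "(f (x + h *\<^sub>R ?g) - f x) / h \<le> C * norm ?g" by linarith
  qed
  ultimately have "?g \<bullet> ?g \<le> C * norm ?g"
    by (rule tendsto_upperbound) simp
  then show ?thesis
    using False by (simp add: dot_square_norm power2_eq_square)
qed

text \<open>
  Along the segment, the derivative of \<open>f\<close> minus its linearisation at \<open>x\<close> grows at most like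
  \<open>L * s * (norm v)\<^sup>2\<close>, so subtracting \<open>L / 2 * s\<^sup>2 * (norm v)\<^sup>2\<close> leaves a nonincreasing function. The sign
  \<open>\<sigma>\<close> covers the upper and the lower estimate at once.
\<close>

lemma smooth_with_taylor:
  assumes "smooth_with L f"
  shows "\<bar>f (x + v) - f x - v \<bullet> gradient f x\<bar> \<le> L / 2 * (norm v)\<^sup>2"
proof -
  have bound: "\<sigma> * (f (x + v) - f x - v \<bullet> gradient f x) \<le> L / 2 * (norm v)\<^sup>2" if "\<bar>\<sigma>\<bar> = 1" for \<sigma> :: real
  proof -
    define h where "h s = \<sigma> * (f (x + s *\<^sub>R v) - s * (v \<bullet> gradient f x)) - L / 2 * s\<^sup>2 * (norm v)\<^sup>2" for s
    have deriv: "(h has_real_derivative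
        \<sigma> * (v \<bullet> gradient f (x + s *\<^sub>R v) - v \<bullet> gradient f x) - L * s * (norm v)\<^sup>2) (at s)" for s
      unfolding h_def
      by (rule derivative_eq_intros smooth_with_DERIV_line[OF assms] refl | simp)+
    have "h 1 \<le> h 0"
    proof (rule DERIV_nonpos_imp_nonincreasing[of 0 1], simp, intro exI conjI, rule deriv)
      fix s :: real assume "0 \<le> s" "s \<le> 1"
      have "\<bar>v \<bullet> gradient f (x + s *\<^sub>R v) - v \<bullet> gradient f x\<bar>
          \<le> norm v * norm (gradient f (x + s *\<^sub>R v) - gradient f x)"
        using Cauchy_Schwarz_ineq2[of v "gradient f (x + s *\<^sub>R v) - gradient f x"]
        by (simp add: inner_diff_right)
      also have "\<dots> \<le> norm v * (L * norm (s *\<^sub>R v))"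
        using smooth_with_norm_gradient_diff[OF assms, of "x + s *\<^sub>R v" x]
        by (intro mult_left_mono) auto
      also have "\<dots> = L * s * (norm v)\<^sup>2"
        using \<open>0 \<le> s\<close> by (simp add: power2_eq_square)
      finally have "\<bar>v \<bullet> gradient f (x + s *\<^sub>R v) - v \<bullet> gradient f x\<bar> \<le> L * s * (norm v)\<^sup>2" .
      moreover have "\<sigma> = 1 \<or> \<sigma> = -1" using that by auto
      ultimately show "\<sigma> * (v \<bullet> gradient f (x + s *\<^sub>R v) - v \<bullet> gradient f x) - L * s * (norm v)\<^sup>2 \<le> 0"
        by auto
    qed
    then show ?thesis by (simp add: h_def algebra_simps)
  qed
  show ?thesis using bound[of 1] bound[of "-1"] by (intro abs_leI) simp_all
qed

text \<open>
  One gradient step of length \<open>1 / L\<close> lowers \<open>f\<close> by at least the squared gradient norm over \<open>2 * L\<close>, and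
  \<open>f\<close> cannot fall below \<open>m\<close>.
\<close>

lemma smooth_with_lower_bound_gradient:
  assumes sm: "smooth_with L f" and "L > 0" and lb: "\<And>y. m \<le> f y"
  shows "(norm (gradient f x))\<^sup>2 \<le> 2 * L * (f x - m)"
proof -
  let ?g = "gradient f x"
  let ?v = "(- (1 / L)) *\<^sub>R ?g"
  have "m \<le> f x + ?v \<bullet> ?g + L / 2 * (norm ?v)\<^sup>2"
    using smooth_with_taylor[OF sm, of x ?v] lb[of "x + ?v"] by linarith
  also have "?v \<bullet> ?g = - ((norm ?g)\<^sup>2 / L)"
    by (simp add: dot_square_norm)
  also have "(norm ?v)\<^sup>2 = (norm ?g)\<^sup>2 / L\<^sup>2"
    by (simp add: power_divide)
  finally show ?thesis
    using \<open>L > 0\<close> by (simp add: field_simps power2_eq_square)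
qed

text \<open>
  The gradient of \<open>\<lambda>y. f y - y \<bullet> gradient f x\<close> at \<open>p\<close> is \<open>gradient f p - gradient f x\<close>, which has norm at most
  \<open>L * r\<close> on the ball. This first-order version of the Taylor estimate compares two points on
  opposite sides of \<open>x\<close> by their distance, which is what the reflection argument below consumes.
\<close>

lemma smooth_with_remainder_lipschitz:
  assumes sm: "smooth_with L f" and "L \<ge> 0" and "y \<in> cball x r" "z \<in> cball x r"
  shows "\<bar>f y - f z - (y - z) \<bullet> gradient f x\<bar> \<le> L * r * norm (y - z)"
proof -
  let ?\<phi> = "\<lambda>y. f y - y \<bullet> gradient f x"
  have "norm (?\<phi> y - ?\<phi> z) \<le> L * r * norm (y - z)"
  proof (rule differentiable_bound[OF convex_cball[of x r]])
    fix p assume p: "p \<in> cball x r"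
    show "(?\<phi> has_derivative (\<lambda>h. h \<bullet> gradient f p - h \<bullet> gradient f x)) (at p within cball x r)"
      by (intro has_derivative_diff smooth_with_has_derivative[OF sm] derivative_intros
          bounded_linear_imp_has_derivative bounded_linear_inner_left)
    show "onorm (\<lambda>h. h \<bullet> gradient f p - h \<bullet> gradient f x) \<le> L * r"
    proof (rule onorm_le)
      fix h
      have "norm (h \<bullet> gradient f p - h \<bullet> gradient f x) \<le> norm h * norm (gradient f p - gradient f x)"
        using Cauchy_Schwarz_ineq2[of h "gradient f p - gradient f x"] by (simp add: inner_diff_right)
      also have "\<dots> \<le> norm h * (L * norm (p - x))"
        by (intro mult_left_mono smooth_with_norm_gradient_diff[OF sm]) auto
      also have "\<dots> \<le> norm h * (L * r)"
        using p \<open>L \<ge> 0\<close> by (intro mult_left_mono) (auto simp: dist_norm norm_minus_commute)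
      finally show "norm (h \<bullet> gradient f p - h \<bullet> gradient f x) \<le> L * r * norm h"
        by (simp add: mult_ac)
    qed
  qed (use assms in auto)
  then show ?thesis
    by (simp add: inner_diff_left algebra_simps)
qed

section \<open>The bias of the one-point estimator\<close>

text \<open>
  Up to the factor \<open>DIM('a) / \<alpha>\<close>, the integral is the inner product of \<open>w\<close> with the mean of the one-point
  gradient estimator, and the claim is that its bias in the direction of \<open>w\<close> is at most \<open>L * \<alpha>\<close>,
  without a factor growing with the dimension. Bounding the Taylor remainder pointwise would lose
  such a factor. Instead the linear part is split off, leaving \<open>\<phi>\<close>, and \<open>u\<close> is averaged with its mirror
  image in the hyperplane orthogonal to \<open>w\<close>. The two points differ by \<open>2 * \<bar>u \<bullet> w\<bar> / norm w\<close>, so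
  \<open>\<phi>\<close> varies by a multiple of \<open>\<bar>u \<bullet> w\<bar>\<close> between them; together with the factor \<open>u \<bullet> w\<close> already
  present this gives the second moment of \<open>u \<bullet> w\<close>, which carries the factor \<open>1 / DIM('a)\<close>. The
  constant \<open>c\<close> drops out because \<open>u \<bullet> w\<close> has mean zero.
\<close>

lemma one_point_estimate_lower_bound:
  fixes f :: "'a::euclidean_space \<Rightarrow> real" and x :: 'a
  assumes sm: "smooth_with L f" and lip: "C-lipschitz_on UNIV f" and "L \<ge> 0" and "\<alpha> \<ge> 0"
  defines "w \<equiv> gradient f x"
  shows "\<alpha> * ((norm w)\<^sup>2 - L * \<alpha> * norm w) / real DIM('a)
    \<le> (\<integral>u. (f (x + \<alpha> *\<^sub>R u) - c) * (u \<bullet> w) \<partial>uniform_sphere)"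
proof (cases "w = 0")
  case False
  have [measurable]: "f \<in> borel_measurable borel"
    by (rule borel_measurable_lipschitz[OF lip])
  define \<phi> where "\<phi> u = f (x + \<alpha> *\<^sub>R u) - \<alpha> * (u \<bullet> w)" for u
  have [measurable]: "\<phi> \<in> borel_measurable borel"
    unfolding \<phi>_def by measurable
  have rem: "\<bar>\<phi> u - \<phi> v\<bar> \<le> L * \<alpha>\<^sup>2 * norm (u - v)" if "norm u = 1" "norm v = 1" for u v
    using smooth_with_remainder_lipschitz[OF sm \<open>L \<ge> 0\<close>, of "x + \<alpha> *\<^sub>R u" x \<alpha> "x + \<alpha> *\<^sub>R v"]
      that \<open>\<alpha> \<ge> 0\<close> scaleR_diff_right[of \<alpha> u v, symmetric]
    by (simp add: \<phi>_def w_def dist_norm inner_diff_left algebra_simps power2_eq_square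
        del: scaleR_diff_right)
  have inner_le: "\<bar>u \<bullet> w\<bar> \<le> norm w" if "norm u = 1" for u
    using Cauchy_Schwarz_ineq2[of u w] that by simp
  obtain e :: 'a where e: "norm e = 1"
    using norm_Basis SOME_Basis by blast
  have \<phi>_bound: "\<bar>\<phi> u\<bar> \<le> \<bar>\<phi> e\<bar> + L * \<alpha>\<^sup>2 * 2" if "norm u = 1" for u
    using rem[OF that e] norm_triangle_ineq4[of u e] that e \<open>L \<ge> 0\<close>
      mult_left_mono[of "norm (u - e)" 2 "L * \<alpha>\<^sup>2"] by simp
  have int_inner: "integrable uniform_sphere (\<lambda>u. u \<bullet> w)"
    using inner_le by (intro integrable_uniform_sphere[where C="norm w"]) auto
  have int_sq: "integrable uniform_sphere (\<lambda>u. (u \<bullet> w)\<^sup>2)"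
  proof (rule integrable_uniform_sphere[where C="(norm w)\<^sup>2"])
    show "\<bar>(u \<bullet> w)\<^sup>2\<bar> \<le> (norm w)\<^sup>2" if "norm u = 1" for u
      using power_mono[OF inner_le[OF that], of 2] by simp
  qed simp
  have int_\<phi>: "integrable uniform_sphere (\<lambda>u. \<phi> u * (u \<bullet> w))"
  proof (rule integrable_uniform_sphere)
    show "\<bar>\<phi> u * (u \<bullet> w)\<bar> \<le> (\<bar>\<phi> e\<bar> + L * \<alpha>\<^sup>2 * 2) * norm w" if "norm u = 1" for u
      unfolding abs_mult using \<phi>_bound[OF that] inner_le[OF that] by (intro mult_mono) auto
  qed measurable
  have int_\<phi>': "integrable uniform_sphere (\<lambda>u. \<phi> (reflect w u) * (u \<bullet> w))"
  proof (rule integrable_uniform_sphere)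
    show "\<bar>\<phi> (reflect w u) * (u \<bullet> w)\<bar> \<le> (\<bar>\<phi> e\<bar> + L * \<alpha>\<^sup>2 * 2) * norm w" if "norm u = 1" for u
      unfolding abs_mult using \<phi>_bound[of "reflect w u"] inner_le[OF that] that \<open>L \<ge> 0\<close>
      by (intro mult_mono) (auto simp: norm_reflect)
  qed measurable
  have avg: "(\<integral>u. - (2 * L * \<alpha>\<^sup>2 / norm w) * (u \<bullet> w)\<^sup>2 \<partial>uniform_sphere)
      = - (2 * (L * \<alpha>\<^sup>2 * norm w / real DIM('a)))"
    using False
    by (simp only: integral_mult_right_zero integral_uniform_sphere_inner_square)
       (simp add: power2_eq_square)
  have mean: "(\<integral>u. u \<bullet> w \<partial>uniform_sphere) = 0"
    using integral_uniform_sphere_reflect[of "\<lambda>u. u \<bullet> w" w] by (simp add: inner_reflect_self)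
  have "(\<integral>u. \<phi> u * (u \<bullet> w) \<partial>uniform_sphere) = - (\<integral>u. \<phi> (reflect w u) * (u \<bullet> w) \<partial>uniform_sphere)"
    using integral_uniform_sphere_reflect[of "\<lambda>u. \<phi> u * (u \<bullet> w)" w]
    by (simp add: inner_reflect_self)
  then have "2 * (\<integral>u. \<phi> u * (u \<bullet> w) \<partial>uniform_sphere)
      = (\<integral>u. \<phi> u * (u \<bullet> w) - \<phi> (reflect w u) * (u \<bullet> w) \<partial>uniform_sphere)"
    using int_\<phi> int_\<phi>' by simp
  also have "\<dots> \<ge> (\<integral>u. - (2 * L * \<alpha>\<^sup>2 / norm w) * (u \<bullet> w)\<^sup>2 \<partial>uniform_sphere)"
  proof (rule integral_mono_AE)
    show "integrable uniform_sphere (\<lambda>u. - (2 * L * \<alpha>\<^sup>2 / norm w) * (u \<bullet> w)\<^sup>2)"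
      using int_sq by (rule integrable_mult_right)
    show "integrable uniform_sphere (\<lambda>u. \<phi> u * (u \<bullet> w) - \<phi> (reflect w u) * (u \<bullet> w))"
      using int_\<phi> int_\<phi>' by simp
    show "AE u in uniform_sphere. - (2 * L * \<alpha>\<^sup>2 / norm w) * (u \<bullet> w)\<^sup>2
        \<le> \<phi> u * (u \<bullet> w) - \<phi> (reflect w u) * (u \<bullet> w)"
      using AE_uniform_sphere
    proof eventually_elim
      case (elim u)
      have "norm (u - reflect w u) = 2 * \<bar>u \<bullet> w\<bar> / norm w"
        using False by (simp add: reflect_def dot_square_norm power2_eq_square)
      then have "\<bar>\<phi> u - \<phi> (reflect w u)\<bar> \<le> (2 * L * \<alpha>\<^sup>2 / norm w) * \<bar>u \<bullet> w\<bar>"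
        using rem[of u "reflect w u"] elim norm_reflect[of w u] by (simp add: mult_ac)
      then have "\<bar>\<phi> u - \<phi> (reflect w u)\<bar> * \<bar>u \<bullet> w\<bar> \<le> (2 * L * \<alpha>\<^sup>2 / norm w) * \<bar>u \<bullet> w\<bar> * \<bar>u \<bullet> w\<bar>"
        by (rule mult_right_mono) simp
      then have "\<bar>(\<phi> u - \<phi> (reflect w u)) * (u \<bullet> w)\<bar> \<le> (2 * L * \<alpha>\<^sup>2 / norm w) * (u \<bullet> w)\<^sup>2"
        by (simp add: abs_mult power2_eq_square mult.assoc)
      then show ?case
        unfolding left_diff_distrib by linarith
    qed
  qed
  finally have "- (L * \<alpha>\<^sup>2 * norm w / real DIM('a)) \<le> (\<integral>u. \<phi> u * (u \<bullet> w) \<partial>uniform_sphere)"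
    unfolding avg by simp
  moreover
  have "(\<integral>u. (f (x + \<alpha> *\<^sub>R u) - c) * (u \<bullet> w) \<partial>uniform_sphere)
      = (\<integral>u. \<phi> u * (u \<bullet> w) + \<alpha> * (u \<bullet> w)\<^sup>2 - c * (u \<bullet> w) \<partial>uniform_sphere)"
    by (simp add: \<phi>_def algebra_simps power2_eq_square)
  then have "(\<integral>u. (f (x + \<alpha> *\<^sub>R u) - c) * (u \<bullet> w) \<partial>uniform_sphere)
      = (\<integral>u. \<phi> u * (u \<bullet> w) \<partial>uniform_sphere) + \<alpha> * ((norm w)\<^sup>2 / real DIM('a))"
    using int_\<phi> int_sq int_inner mean by (simp add: integral_uniform_sphere_inner_square)
  moreover have "\<alpha> * ((norm w)\<^sup>2 - L * \<alpha> * norm w) / real DIM('a)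
      = \<alpha> * ((norm w)\<^sup>2 / real DIM('a)) - L * \<alpha>\<^sup>2 * norm w / real DIM('a)"
    by (simp add: field_simps power2_eq_square)
  ultimately show ?thesis
    by linarith
qed simp

section \<open>Pathwise estimates for the iterates\<close>

text \<open>
  This is convexity of the square with weights \<open>1 / 12\<close>, \<open>1 / 4\<close> and \<open>2 / 3\<close>, followed by
  \<open>(c - c')\<^sup>2 \<le> 2 * c\<^sup>2 + 2 * c'\<^sup>2\<close>. The weights are chosen for the final count: the coefficient \<open>4\<close> of \<open>b\<^sup>2\<close> keeps the
  recursion for the residuals a contraction, and the coefficient \<open>3\<close> keeps the gradient terms it
  produces at no more than half of those gained by descent, up to the term from the initial point.
\<close>

lemma square_sum_weighted:
  fixes a b c c' :: real
  shows "(a + b + (c - c'))\<^sup>2 \<le> 12 * a\<^sup>2 + 4 * b\<^sup>2 + 3 * (c\<^sup>2 + c'\<^sup>2)"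
proof -
  have "12 * a\<^sup>2 + 4 * b\<^sup>2 + 3 * (c\<^sup>2 + c'\<^sup>2) - (a + b + (c - c'))\<^sup>2
      = (3 * a - b)\<^sup>2 + ((c - c') - 2 * a - 2 * b)\<^sup>2 / 2 + 3 / 2 * (c + c')\<^sup>2"
    by (simp add: power2_eq_square field_simps)
  then show ?thesis
    using zero_le_power2[of "3 * a - b"] zero_le_power2[of "(c - c') - 2 * a - 2 * b"]
      zero_le_power2[of "c + c'"] by argo
qed

text \<open>
  The setting of the pathwise analysis, in which the sequence \<open>v\<close> of directions is arbitrary and not random.
  The step size \<open>\<alpha> / (4 * DIM('a) * L0)\<close> is built into the iterates. It turns the update into a move by
  \<open>residual / (4 * L0)\<close> along the current direction, in which neither \<open>\<alpha>\<close> nor the dimension appears.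
\<close>

locale residual_feedback =
  fixes f :: "'a::euclidean_space \<Rightarrow> real" and L0 L \<alpha> :: real and x1 :: 'a
  assumes L0_pos: "L0 > 0" and L_pos: "L > 0" and \<alpha>_pos: "\<alpha> > 0"
    and lipschitz: "L0-lipschitz_on UNIV f"
    and smooth: "smooth_with L f"
begin

definition iterate :: "(nat \<Rightarrow> 'a) \<Rightarrow> nat \<Rightarrow> 'a" where
  "iterate v t = residual_iterate f (\<alpha> / (4 * real DIM('a) * L0)) \<alpha> x1 v t"

definition eval_point :: "(nat \<Rightarrow> 'a) \<Rightarrow> nat \<Rightarrow> 'a" where
  "eval_point v t = iterate v t + \<alpha> *\<^sub>R v t"

text \<open>
  The residual at step \<open>0\<close> is set to \<open>0\<close>. The two initial iterates coincide, so with this convention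
  the update rule and the recursion for the squares hold from step \<open>0\<close> on.
\<close>

definition residual :: "(nat \<Rightarrow> 'a) \<Rightarrow> nat \<Rightarrow> real" where
  "residual v t = (if t = 0 then 0 else f (eval_point v t) - f (eval_point v (t - 1)))"

lemma residual_0 [simp]: "residual v 0 = 0"
  by (simp add: residual_def)

lemma residual_Suc: "residual v (Suc t) = f (eval_point v (Suc t)) - f (eval_point v t)"
  by (simp add: residual_def)

lemma iterate_0 [simp]: "iterate v 0 = x1" "iterate v (Suc 0) = x1"
  by (simp_all add: iterate_def)

lemma iterate_Suc: "iterate v (Suc t) = iterate v t - (residual v t / (4 * L0)) *\<^sub>R v t"
proof (cases t)
  case (Suc s)
  have "\<alpha> / (4 * real DIM('a) * L0) * (real DIM('a) * (r / \<alpha>)) = r / (4 * L0)" for r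
    using \<alpha>_pos L0_pos by (simp add: field_simps)
  then show ?thesis
    by (simp add: Suc iterate_def residual_Suc eval_point_def Let_def)
qed simp

lemma f_diff_le: "\<bar>f x - f y\<bar> \<le> L0 * norm (x - y)"
  using lipschitz_onD[OF lipschitz, of x y] by (simp add: dist_norm)

lemma norm_gradient_le: "norm (gradient f x) \<le> L0"
  by (rule norm_gradient_le_lipschitz[OF smooth lipschitz])

lemma borel_measurable_f [measurable]: "f \<in> borel_measurable borel"
  by (rule borel_measurable_lipschitz[OF lipschitz])

lemma borel_measurable_gradient_f [measurable]: "gradient f \<in> borel_measurable borel"
  by (rule borel_measurable_gradient[OF smooth])

lemma norm_iterate_step:
  assumes "norm (v t) = 1"
  shows "norm (iterate v (Suc t) - iterate v t) = \<bar>residual v t\<bar> / (4 * L0)"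
  using assms L0_pos by (simp add: iterate_Suc)

lemma f_iterate_step:
  assumes "norm (v t) = 1"
  shows "\<bar>f (iterate v (Suc t)) - f (iterate v t)\<bar> \<le> \<bar>residual v t\<bar> / 4"
  using f_diff_le[of "iterate v (Suc t)" "iterate v t"] norm_iterate_step[of v t, OF assms] L0_pos
  by simp

text \<open>
  The two evaluation points differ by the last step, which contributes a quarter of the previous
  residual, and by two perturbations of length \<open>\<alpha>\<close>. Hence the residuals satisfy a contraction with
  fixed point \<open>8 / 3 * L0 * \<alpha>\<close>. The bound serves only to make all random variables integrable.
\<close>

lemma residual_bounded:
  assumes "\<And>s. s \<le> t \<Longrightarrow> norm (v s) = 1"
  shows "\<bar>residual v t\<bar> \<le> 3 * L0 * \<alpha>"
  using assms
proof (induction t)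
  case 0
  then show ?case using L0_pos \<alpha>_pos by simp
next
  case (Suc t)
  have IH: "\<bar>residual v t\<bar> \<le> 3 * L0 * \<alpha>"
    using Suc by simp
  have v: "norm (v t) = 1" "norm (v (Suc t)) = 1"
    using Suc.prems by simp_all
  have "eval_point v (Suc t) - eval_point v t
      = (iterate v (Suc t) - iterate v t) + \<alpha> *\<^sub>R (v (Suc t) - v t)"
    by (simp add: eval_point_def algebra_simps)
  then have "norm (eval_point v (Suc t) - eval_point v t)
      \<le> norm (iterate v (Suc t) - iterate v t) + \<alpha> * norm (v (Suc t) - v t)"
    using norm_triangle_ineq[of "iterate v (Suc t) - iterate v t" "\<alpha> *\<^sub>R (v (Suc t) - v t)"] \<alpha>_pos
    by simp
  also have "\<dots> \<le> \<bar>residual v t\<bar> / (4 * L0) + \<alpha> * 2"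
    using norm_iterate_step[of v t] norm_triangle_ineq4[of "v (Suc t)" "v t"] v \<alpha>_pos
    by (intro add_mono mult_left_mono) auto
  finally have "L0 * norm (eval_point v (Suc t) - eval_point v t)
      \<le> L0 * (\<bar>residual v t\<bar> / (4 * L0) + \<alpha> * 2)"
    using L0_pos by (intro mult_left_mono) auto
  also have "\<dots> = \<bar>residual v t\<bar> / 4 + 2 * L0 * \<alpha>"
    using L0_pos by (simp add: field_simps)
  also have "\<dots> \<le> 3 * L0 * \<alpha>"
  proof -
    have "0 \<le> L0 * \<alpha>" using L0_pos \<alpha>_pos by simp
    then show ?thesis using IH by linarith
  qed
  finally show ?case
    using f_diff_le[of "eval_point v (Suc t)" "eval_point v t"] by (simp add: residual_Suc)
qed

lemma f_iterate_bounded: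
  assumes "\<And>s. s < t \<Longrightarrow> norm (v s) = 1"
  shows "\<bar>f (iterate v t) - f x1\<bar> \<le> real t * (L0 * \<alpha>)"
  using assms
proof (induction t)
  case (Suc t)
  have "\<bar>residual v t\<bar> \<le> 3 * L0 * \<alpha>"
    using Suc.prems by (intro residual_bounded) simp
  moreover have "0 \<le> L0 * \<alpha>" using L0_pos \<alpha>_pos by simp
  moreover have "\<bar>f (iterate v t) - f x1\<bar> \<le> real t * (L0 * \<alpha>)"
    using Suc by simp
  moreover have "\<bar>f (iterate v (Suc t)) - f (iterate v t)\<bar> \<le> \<bar>residual v t\<bar> / 4"
    using Suc.prems by (intro f_iterate_step) simp
  moreover have "real (Suc t) * (L0 * \<alpha>) = L0 * \<alpha> + real t * (L0 * \<alpha>)"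
    by (simp add: algebra_simps)
  ultimately show ?case
    by linarith
qed simp

lemma descent_step:
  assumes "norm (v t) = 1"
  shows "f (iterate v (Suc t)) \<le> f (iterate v t)
    - residual v t * (v t \<bullet> gradient f (iterate v t)) / (4 * L0)
    + L / (32 * L0\<^sup>2) * (residual v t)\<^sup>2"
proof -
  let ?h = "iterate v (Suc t) - iterate v t"
  have "f (iterate v (Suc t)) \<le> f (iterate v t) + ?h \<bullet> gradient f (iterate v t) + L / 2 * (norm ?h)\<^sup>2"
    using abs_le_D1[OF smooth_with_taylor[OF smooth, of "iterate v t" ?h]] by simp
  also have "(norm ?h)\<^sup>2 = (residual v t)\<^sup>2 / (16 * L0\<^sup>2)"
    by (simp add: norm_iterate_step[of v t, OF assms] power_divide power_mult_distrib)
  also have "?h \<bullet> gradient f (iterate v t) = - (residual v t * (v t \<bullet> gradient f (iterate v t)) / (4 * L0))"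
    by (simp add: iterate_Suc)
  finally show ?thesis by simp
qed

text \<open>
  The residual splits into three parts: the Taylor remainders \<open>r\<close> at the two evaluation points, of
  order \<open>L * \<alpha>\<^sup>2\<close>; the change \<open>b\<close> of \<open>f\<close> between the iterates, which is at most a quarter of the previous
  residual; and the difference of the two slopes \<open>c\<close> along the sampled directions. The slopes are not
  bounded by \<open>L0\<close> here, because their second moments are small: the squared gradient norm over the
  dimension.
\<close>

lemma residual_square_recursion:
  assumes "norm (v t) = 1" "norm (v (Suc t)) = 1"
  shows "(residual v (Suc t))\<^sup>2 \<le> 12 * L\<^sup>2 * \<alpha> ^ 4 + (residual v t)\<^sup>2 / 4
    + 3 * \<alpha>\<^sup>2 * ((v (Suc t) \<bullet> gradient f (iterate v (Suc t)))\<^sup>2 + (v t \<bullet> gradient f (iterate v t))\<^sup>2)"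
proof -
  define c where "c s = \<alpha> * (v s \<bullet> gradient f (iterate v s))" for s
  define r where "r s = f (eval_point v s) - f (iterate v s) - c s" for s
  have r: "\<bar>r s\<bar> \<le> L * \<alpha>\<^sup>2 / 2" if "norm (v s) = 1" for s
    using smooth_with_taylor[OF smooth, of "iterate v s" "\<alpha> *\<^sub>R v s"] that \<alpha>_pos
    by (simp add: r_def c_def eval_point_def)
  define b where "b = f (iterate v (Suc t)) - f (iterate v t)"
  have "residual v (Suc t) = (r (Suc t) - r t) + b + (c (Suc t) - c t)"
    by (simp add: residual_Suc r_def b_def)
  then have "(residual v (Suc t))\<^sup>2
      \<le> 12 * (r (Suc t) - r t)\<^sup>2 + 4 * b\<^sup>2 + 3 * ((c (Suc t))\<^sup>2 + (c t)\<^sup>2)"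
    using square_sum_weighted by metis
  moreover have "\<bar>r (Suc t) - r t\<bar> \<le> L * \<alpha>\<^sup>2"
    using r[OF assms(1)] r[OF assms(2)] by linarith
  then have "(r (Suc t) - r t)\<^sup>2 \<le> (L * \<alpha>\<^sup>2)\<^sup>2"
    using power_mono[of "\<bar>r (Suc t) - r t\<bar>" "L * \<alpha>\<^sup>2" 2] by simp
  moreover have "b\<^sup>2 \<le> (residual v t)\<^sup>2 / 16"
    using power_mono[OF f_iterate_step[of v t, OF assms(1)], of 2] by (simp add: b_def power_divide)
  ultimately show ?thesis
    by (simp add: c_def power_mult_distrib distrib_left)
qed

lemma iterate_cong:
  assumes "\<And>s. s < t \<Longrightarrow> v s = v' s"
  shows "iterate v t = iterate v' t"
  unfolding iterate_def using assms
proof (induction f "\<alpha> / (4 * real DIM('a) * L0)" \<alpha> x1 v t rule: residual_iterate.induct)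
  case (3 f \<alpha> x1 v t)
  then show ?case by simp
qed simp_all

lemma borel_measurable_iterate:
  assumes "\<And>s. s < t \<Longrightarrow> (\<lambda>\<omega>. V \<omega> s) \<in> borel_measurable N"
  shows "(\<lambda>\<omega>. iterate (V \<omega>) t) \<in> borel_measurable N"
  using assms
proof (induction t rule: less_induct)
  case (less t)
  show ?case
  proof (cases t)
    case (Suc s)
    have [measurable]: "(\<lambda>\<omega>. V \<omega> s) \<in> borel_measurable N" "(\<lambda>\<omega>. V \<omega> (s - 1)) \<in> borel_measurable N"
      "(\<lambda>\<omega>. iterate (V \<omega>) s) \<in> borel_measurable N" "(\<lambda>\<omega>. iterate (V \<omega>) (s - 1)) \<in> borel_measurable N"
      using less Suc by (auto intro!: less.IH)
    show ?thesis
      unfolding Suc iterate_Suc residual_def eval_point_def by measurable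
  qed simp
qed

end

section \<open>Expectations over the random directions\<close>

text \<open>
  Conditioning on \<open>X\<close> in the form in which it is used: an independent \<open>Y\<close> may be integrated out first,
  with \<open>X\<close> frozen.
\<close>

lemma (in prob_space) indep_var_integral_fst:
  fixes \<Phi> :: "'b \<times> 'b \<Rightarrow> real"
  assumes indep: "indep_var N1 X N2 Y"
    and [measurable]: "\<Phi> \<in> borel_measurable (N1 \<Otimes>\<^sub>M N2)"
    and int: "integrable M (\<lambda>\<omega>. \<Phi> (X \<omega>, Y \<omega>))"
  shows "integrable M (\<lambda>\<omega>. \<integral>y. \<Phi> (X \<omega>, y) \<partial>distr M N2 Y)"
    and "expectation (\<lambda>\<omega>. \<Phi> (X \<omega>, Y \<omega>)) = expectation (\<lambda>\<omega>. \<integral>y. \<Phi> (X \<omega>, y) \<partial>distr M N2 Y)"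
proof -
  have [measurable]: "random_variable N1 X" "random_variable N2 Y"
    using indep_var_rv1[OF indep] indep_var_rv2[OF indep] .
  interpret X: prob_space "distr M N1 X" by (rule prob_space_distr) simp
  interpret Y: prob_space "distr M N2 Y" by (rule prob_space_distr) simp
  interpret XY: pair_prob_space "distr M N1 X" "distr M N2 Y" ..
  have joint: "distr M N1 X \<Otimes>\<^sub>M distr M N2 Y = distr M (N1 \<Otimes>\<^sub>M N2) (\<lambda>\<omega>. (X \<omega>, Y \<omega>))"
    using indep by (simp add: indep_var_distribution_eq)
  have int': "integrable (distr M N1 X \<Otimes>\<^sub>M distr M N2 Y) \<Phi>"
    unfolding joint by (subst integrable_distr_eq) (use int in auto)
  have [measurable]: "(\<lambda>x. \<integral>y. \<Phi> (x, y) \<partial>distr M N2 Y) \<in> borel_measurable N1"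
    using borel_measurable_integrable[OF XY.integrable_fst'[OF int']] by simp
  show "integrable M (\<lambda>\<omega>. \<integral>y. \<Phi> (X \<omega>, y) \<partial>distr M N2 Y)"
    using XY.integrable_fst'[OF int'] by (simp add: integrable_distr_eq)
  have "expectation (\<lambda>\<omega>. \<Phi> (X \<omega>, Y \<omega>)) = (\<integral>z. \<Phi> z \<partial>(distr M N1 X \<Otimes>\<^sub>M distr M N2 Y))"
    unfolding joint by (subst integral_distr) auto
  also have "\<dots> = (\<integral>x. \<integral>y. \<Phi> (x, y) \<partial>distr M N2 Y \<partial>distr M N1 X)"
    using XY.integral_fst'[OF int'] by simp
  also have "\<dots> = expectation (\<lambda>\<omega>. \<integral>y. \<Phi> (X \<omega>, y) \<partial>distr M N2 Y)"
    by (subst integral_distr) auto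
  finally show "expectation (\<lambda>\<omega>. \<Phi> (X \<omega>, Y \<omega>)) = expectation (\<lambda>\<omega>. \<integral>y. \<Phi> (X \<omega>, y) \<partial>distr M N2 Y)" .
qed

text \<open>
  From here on the directions are random. The expectations of the pathwise inequalities are taken
  one step at a time, each time integrating out the newest direction first.
\<close>

locale residual_feedback_run = residual_feedback f L0 L \<alpha> x1 + prob_space M
  for f :: "'a::euclidean_space \<Rightarrow> real" and L0 L \<alpha> :: real and x1 :: 'a and M :: "'b measure" +
  fixes u :: "nat \<Rightarrow> 'b \<Rightarrow> 'a" and T :: nat
  assumes indep: "indep_vars (\<lambda>_. borel) u {0..T}"
    and uniform: "\<And>t. t \<le> T \<Longrightarrow> distr M borel (u t) = uniform_sphere"
begin

text \<open>
  The directions along the sample path \<open>\<omega>\<close>, as an argument for the pathwise notions.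
\<close>

definition dirs :: "'b \<Rightarrow> nat \<Rightarrow> 'a" where
  "dirs \<omega> t = u t \<omega>"

definition mean_square_gradient :: "nat \<Rightarrow> real" where
  "mean_square_gradient t = expectation (\<lambda>\<omega>. (norm (gradient f (iterate (dirs \<omega>) t)))\<^sup>2)"

definition mean_square_residual :: "nat \<Rightarrow> real" where
  "mean_square_residual t = expectation (\<lambda>\<omega>. (residual (dirs \<omega>) t)\<^sup>2)"

lemma borel_measurable_dirs: "t \<le> T \<Longrightarrow> (\<lambda>\<omega>. dirs \<omega> t) \<in> borel_measurable M"
  using indep by (auto simp: indep_vars_def2 dirs_def)

lemma borel_measurable_iterate_dirs:
  "t \<le> Suc T \<Longrightarrow> (\<lambda>\<omega>. iterate (dirs \<omega>) t) \<in> borel_measurable M"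
  by (intro borel_measurable_iterate borel_measurable_dirs) auto

lemma borel_measurable_residual_dirs:
  assumes "t \<le> T"
  shows "(\<lambda>\<omega>. residual (dirs \<omega>) t) \<in> borel_measurable M"
proof -
  have [measurable]: "(\<lambda>\<omega>. dirs \<omega> t) \<in> borel_measurable M" "(\<lambda>\<omega>. dirs \<omega> (t - 1)) \<in> borel_measurable M"
    "(\<lambda>\<omega>. iterate (dirs \<omega>) t) \<in> borel_measurable M"
    "(\<lambda>\<omega>. iterate (dirs \<omega>) (t - 1)) \<in> borel_measurable M"
    using assms by (auto intro!: borel_measurable_dirs borel_measurable_iterate_dirs)
  show ?thesis unfolding residual_def eval_point_def by measurable
qed

lemma AE_norm_dirs: "AE \<omega> in M. \<forall>t\<le>T. norm (dirs \<omega> t) = 1"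
proof -
  have "AE \<omega> in M. norm (dirs \<omega> t) = 1" if "t \<le> T" for t
  proof -
    have [measurable]: "u t \<in> borel_measurable M"
      using borel_measurable_dirs[OF that] by (simp add: dirs_def)
    have "AE v in distr M borel (u t). norm v = 1"
      unfolding uniform[OF that] by (rule AE_uniform_sphere)
    then show ?thesis
      by (simp add: AE_distr_iff dirs_def)
  qed
  then have "AE \<omega> in M. \<forall>t\<in>{..T}. norm (dirs \<omega> t) = 1"
    by (intro AE_finite_allI) auto
  then show ?thesis by (simp add: Ball_def)
qed

lemma integrable_bounded:
  fixes h :: "'b \<Rightarrow> real"
  assumes "h \<in> borel_measurable M"
    and "\<And>\<omega>. (\<And>t. t \<le> T \<Longrightarrow> norm (dirs \<omega> t) = 1) \<Longrightarrow> \<bar>h \<omega>\<bar> \<le> C"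
  shows "integrable M h"
  by (rule integrable_const_bound[where B=C]) (use AE_norm_dirs assms in auto)

lemma abs_inner_gradient_le: "norm v = 1 \<Longrightarrow> \<bar>v \<bullet> gradient f x\<bar> \<le> L0"
  using Cauchy_Schwarz_ineq2[of v "gradient f x"] norm_gradient_le[of x] by simp

lemma integrable_residual_square:
  assumes "t \<le> T"
  shows "integrable M (\<lambda>\<omega>. (residual (dirs \<omega>) t)\<^sup>2)"
proof (rule integrable_bounded)
  show "(\<lambda>\<omega>. (residual (dirs \<omega>) t)\<^sup>2) \<in> borel_measurable M"
    using borel_measurable_residual_dirs[OF assms] by measurable
  fix \<omega> assume "\<And>t. t \<le> T \<Longrightarrow> norm (dirs \<omega> t) = 1"
  then show "\<bar>(residual (dirs \<omega>) t)\<^sup>2\<bar> \<le> (3 * L0 * \<alpha>)\<^sup>2"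
    using power_mono[OF residual_bounded[of t "dirs \<omega>"], of 2] assms by simp
qed

lemma integrable_gradient_square:
  assumes "t \<le> Suc T"
  shows "integrable M (\<lambda>\<omega>. (norm (gradient f (iterate (dirs \<omega>) t)))\<^sup>2)"
proof (rule integrable_bounded)
  have [measurable]: "(\<lambda>\<omega>. iterate (dirs \<omega>) t) \<in> borel_measurable M"
    by (rule borel_measurable_iterate_dirs[OF assms])
  show "(\<lambda>\<omega>. (norm (gradient f (iterate (dirs \<omega>) t)))\<^sup>2) \<in> borel_measurable M"
    by measurable
  show "\<bar>(norm (gradient f (iterate (dirs \<omega>) t)))\<^sup>2\<bar> \<le> L0\<^sup>2" for \<omega>
    using power_mono[OF norm_gradient_le, of _ 2] by simp
qed

lemma integrable_slope_square:
  assumes "t \<le> T"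
  shows "integrable M (\<lambda>\<omega>. (dirs \<omega> t \<bullet> gradient f (iterate (dirs \<omega>) t))\<^sup>2)"
proof (rule integrable_bounded)
  have [measurable]: "(\<lambda>\<omega>. iterate (dirs \<omega>) t) \<in> borel_measurable M" "(\<lambda>\<omega>. dirs \<omega> t) \<in> borel_measurable M"
    using assms by (auto intro!: borel_measurable_iterate_dirs borel_measurable_dirs)
  show "(\<lambda>\<omega>. (dirs \<omega> t \<bullet> gradient f (iterate (dirs \<omega>) t))\<^sup>2) \<in> borel_measurable M"
    by measurable
  fix \<omega> assume "\<And>t. t \<le> T \<Longrightarrow> norm (dirs \<omega> t) = 1"
  then show "\<bar>(dirs \<omega> t \<bullet> gradient f (iterate (dirs \<omega>) t))\<^sup>2\<bar> \<le> L0\<^sup>2"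
    using power_mono[OF abs_inner_gradient_le[of "dirs \<omega> t"], of _ 2] assms by simp
qed

lemma integrable_residual_slope:
  assumes "t \<le> T"
  shows "integrable M (\<lambda>\<omega>. residual (dirs \<omega>) t * (dirs \<omega> t \<bullet> gradient f (iterate (dirs \<omega>) t)))"
proof (rule integrable_bounded)
  have [measurable]: "(\<lambda>\<omega>. iterate (dirs \<omega>) t) \<in> borel_measurable M" "(\<lambda>\<omega>. dirs \<omega> t) \<in> borel_measurable M"
    "(\<lambda>\<omega>. residual (dirs \<omega>) t) \<in> borel_measurable M"
    using assms by (auto intro!: borel_measurable_iterate_dirs borel_measurable_dirs
        borel_measurable_residual_dirs)
  show "(\<lambda>\<omega>. residual (dirs \<omega>) t * (dirs \<omega> t \<bullet> gradient f (iterate (dirs \<omega>) t))) \<in> borel_measurable M"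
    by measurable
  fix \<omega> assume "\<And>t. t \<le> T \<Longrightarrow> norm (dirs \<omega> t) = 1"
  then show "\<bar>residual (dirs \<omega>) t * (dirs \<omega> t \<bullet> gradient f (iterate (dirs \<omega>) t))\<bar> \<le> (3 * L0 * \<alpha>) * L0"
    unfolding abs_mult using assms L0_pos \<alpha>_pos
    by (intro mult_mono residual_bounded abs_inner_gradient_le) auto
qed

lemma integrable_f_iterate:
  assumes "t \<le> Suc T"
  shows "integrable M (\<lambda>\<omega>. f (iterate (dirs \<omega>) t))"
proof (rule integrable_bounded)
  have [measurable]: "(\<lambda>\<omega>. iterate (dirs \<omega>) t) \<in> borel_measurable M"
    by (rule borel_measurable_iterate_dirs[OF assms])
  show "(\<lambda>\<omega>. f (iterate (dirs \<omega>) t)) \<in> borel_measurable M"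
    by measurable
  fix \<omega> assume "\<And>t. t \<le> T \<Longrightarrow> norm (dirs \<omega> t) = 1"
  then show "\<bar>f (iterate (dirs \<omega>) t)\<bar> \<le> \<bar>f x1\<bar> + real t * (L0 * \<alpha>)"
    using f_iterate_bounded[of t "dirs \<omega>"] assms by simp
qed

text \<open>
  All that step \<open>t\<close> knows of the past: its iterate and, for \<open>t > 0\<close>, the function value it reuses.
  Both are determined by the directions before \<open>t\<close>, hence independent of direction \<open>t\<close>.
\<close>

definition history :: "nat \<Rightarrow> (nat \<Rightarrow> 'a) \<Rightarrow> 'a \<times> real" where
  "history t v = (iterate v t, if t = 0 then 0 else f (eval_point v (t - 1)))"

lemma measurable_history:
  "history t \<in> measurable (PiM {..<t} (\<lambda>_. borel)) (borel \<Otimes>\<^sub>M borel)"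
proof (cases "t = 0")
  case False
  let ?P = "PiM {..<t} (\<lambda>_. borel) :: (nat \<Rightarrow> 'a) measure"
  have [measurable]: "(\<lambda>v. v (t - 1)) \<in> borel_measurable ?P"
    using False by (intro measurable_component_singleton) auto
  have iterate: "(\<lambda>v. iterate v s) \<in> borel_measurable ?P" if "s \<le> t" for s
    using that by (intro borel_measurable_iterate measurable_component_singleton) auto
  have [measurable]: "(\<lambda>v. iterate v t) \<in> borel_measurable ?P"
    "(\<lambda>v. iterate v (t - 1)) \<in> borel_measurable ?P"
    by (auto intro!: iterate)
  show ?thesis
    unfolding history_def eval_point_def by measurable
qed (simp add: history_def[abs_def])

text \<open>
  The history is a function of the directions with index below \<open>t\<close>, and these are independent of
  the direction with index \<open>t\<close>, whose law is uniform on the sphere.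
\<close>

lemma integral_fresh_direction:
  fixes \<Phi> :: "('a \<times> real) \<times> 'a \<Rightarrow> real"
  assumes t: "t \<le> T"
    and [measurable]: "\<Phi> \<in> borel_measurable ((borel \<Otimes>\<^sub>M borel) \<Otimes>\<^sub>M borel)"
    and int: "integrable M (\<lambda>\<omega>. \<Phi> (history t (dirs \<omega>), dirs \<omega> t))"
  shows "integrable M (\<lambda>\<omega>. \<integral>y. \<Phi> (history t (dirs \<omega>), y) \<partial>uniform_sphere)"
    and "expectation (\<lambda>\<omega>. \<Phi> (history t (dirs \<omega>), dirs \<omega> t))
      = expectation (\<lambda>\<omega>. \<integral>y. \<Phi> (history t (dirs \<omega>), y) \<partial>uniform_sphere)"
proof -
  let ?P = "\<lambda>A. PiM A (\<lambda>_. borel) :: (nat \<Rightarrow> 'a) measure"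
  let ?R = "\<lambda>A \<omega>. restrict (\<lambda>i. u i \<omega>) A"
  have ind: "indep_var (?P {..<t}) (?R {..<t}) (?P {t}) (?R {t})"
    using t by (intro indep_var_restrict[OF indep]) auto
  have [measurable]: "(\<lambda>v. v t) \<in> measurable (?P {t}) borel"
    by (intro measurable_component_singleton) auto
  have [measurable]: "?R {t} \<in> measurable M (?P {t})"
    by (rule indep_var_rv2[OF ind])
  note measurable_history[measurable]
  have meas: "(\<lambda>pq. \<Phi> (history t (fst pq), snd pq t)) \<in> borel_measurable (?P {..<t} \<Otimes>\<^sub>M ?P {t})"
    by measurable
  have past: "history t (?R {..<t} \<omega>) = history t (dirs \<omega>)" for \<omega>
    unfolding history_def eval_point_def
    by (auto simp: dirs_def intro!: arg_cong[where f=f] arg_cong2[where f="(+)"] iterate_cong)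
  have fresh: "?R {t} \<omega> t = dirs \<omega> t" for \<omega>
    by (simp add: dirs_def)
  have law: "(\<integral>q. \<Phi> (z, q t) \<partial>distr M (?P {t}) (?R {t})) = (\<integral>y. \<Phi> (z, y) \<partial>uniform_sphere)" for z
  proof -
    have [measurable]: "u t \<in> borel_measurable M"
      using borel_measurable_dirs[OF t] by (simp add: dirs_def)
    have "(\<integral>q. \<Phi> (z, q t) \<partial>distr M (?P {t}) (?R {t})) = (\<integral>\<omega>. \<Phi> (z, u t \<omega>) \<partial>M)"
      by (subst integral_distr) (auto simp: space_pair_measure)
    also have "\<dots> = (\<integral>y. \<Phi> (z, y) \<partial>distr M borel (u t))"
      by (subst integral_distr) (auto simp: space_pair_measure)
    finally show ?thesis by (simp add: uniform[OF t])
  qed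
  have "integrable M (\<lambda>\<omega>. (\<lambda>pq. \<Phi> (history t (fst pq), snd pq t)) (?R {..<t} \<omega>, ?R {t} \<omega>))"
    using int by (simp add: past dirs_def)
  note cond = indep_var_integral_fst[OF ind meas this]
  show "integrable M (\<lambda>\<omega>. \<integral>y. \<Phi> (history t (dirs \<omega>), y) \<partial>uniform_sphere)"
    using cond(1) unfolding fst_conv snd_conv past law .
  show "expectation (\<lambda>\<omega>. \<Phi> (history t (dirs \<omega>), dirs \<omega> t))
      = expectation (\<lambda>\<omega>. \<integral>y. \<Phi> (history t (dirs \<omega>), y) \<partial>uniform_sphere)"
    using cond(2) unfolding fst_conv snd_conv past law fresh .
qed

lemma mean_slope_square:
  assumes "t \<le> T"
  shows "expectation (\<lambda>\<omega>. (dirs \<omega> t \<bullet> gradient f (iterate (dirs \<omega>) t))\<^sup>2)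
    = mean_square_gradient t / real DIM('a)"
proof -
  define \<Phi> where "\<Phi> zy = (snd zy \<bullet> gradient f (fst (fst zy)))\<^sup>2" for zy :: "('a \<times> real) \<times> 'a"
  have "\<Phi> \<in> borel_measurable ((borel \<Otimes>\<^sub>M borel) \<Otimes>\<^sub>M borel)"
    unfolding \<Phi>_def by measurable
  from integral_fresh_direction(2)[OF assms this]
  show ?thesis
    using integrable_slope_square[OF assms]
    by (simp add: \<Phi>_def history_def integral_uniform_sphere_inner_square mean_square_gradient_def)
qed

text \<open>
  With the history frozen, the reused function value is a constant, and the one-point estimate
  applies. The bias term is absorbed by \<open>2 * (L * \<alpha> * n) \<le> n\<^sup>2 + L\<^sup>2 * \<alpha>\<^sup>2\<close>, where \<open>n\<close> is the gradient norm. Step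
  \<open>0\<close> is excluded because its residual is \<open>0\<close> by convention.
\<close>

lemma mean_drift_lower_bound:
  assumes "1 \<le> t" "t \<le> T"
  shows "\<alpha> / (2 * real DIM('a)) * (mean_square_gradient t - L\<^sup>2 * \<alpha>\<^sup>2)
    \<le> expectation (\<lambda>\<omega>. residual (dirs \<omega>) t * (dirs \<omega> t \<bullet> gradient f (iterate (dirs \<omega>) t)))"
proof -
  define \<Phi> where "\<Phi> zy = (f (fst (fst zy) + \<alpha> *\<^sub>R snd zy) - snd (fst zy)) * (snd zy \<bullet> gradient f (fst (fst zy)))"
    for zy :: "('a \<times> real) \<times> 'a"
  have \<Phi>: "\<Phi> \<in> borel_measurable ((borel \<Otimes>\<^sub>M borel) \<Otimes>\<^sub>M borel)"
    unfolding \<Phi>_def by measurable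
  have eq: "\<Phi> (history t (dirs \<omega>), dirs \<omega> t)
      = residual (dirs \<omega>) t * (dirs \<omega> t \<bullet> gradient f (iterate (dirs \<omega>) t))" for \<omega>
    using assms by (simp add: \<Phi>_def history_def residual_def eval_point_def)
  note cond = integral_fresh_direction[OF assms(2) \<Phi>, unfolded eq,
      OF integrable_residual_slope[OF assms(2)]]
  have pointwise: "\<alpha> / (2 * real DIM('a)) * ((norm (gradient f x))\<^sup>2 - L\<^sup>2 * \<alpha>\<^sup>2)
      \<le> (\<integral>y. \<Phi> ((x, c), y) \<partial>uniform_sphere)" for x c
  proof -
    let ?n = "norm (gradient f x)"
    have "2 * (L * \<alpha> * ?n) \<le> ?n\<^sup>2 + L\<^sup>2 * \<alpha>\<^sup>2"
      using sum_squares_bound[of ?n "L * \<alpha>"] by (simp add: power_mult_distrib mult_ac)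
    then have "\<alpha> / (2 * real DIM('a)) * (?n\<^sup>2 - L\<^sup>2 * \<alpha>\<^sup>2)
        \<le> \<alpha> / (2 * real DIM('a)) * (2 * (?n\<^sup>2 - L * \<alpha> * ?n))"
      using \<alpha>_pos by (intro mult_left_mono) auto
    also have "\<dots> = \<alpha> * (?n\<^sup>2 - L * \<alpha> * ?n) / real DIM('a)"
      by (simp add: field_simps)
    also have "\<dots> \<le> (\<integral>y. \<Phi> ((x, c), y) \<partial>uniform_sphere)"
      unfolding \<Phi>_def fst_conv snd_conv
      using L_pos \<alpha>_pos by (intro one_point_estimate_lower_bound[OF smooth lipschitz]) auto
    finally show ?thesis .
  qed
  have "\<alpha> / (2 * real DIM('a)) * (mean_square_gradient t - L\<^sup>2 * \<alpha>\<^sup>2)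
      = expectation (\<lambda>\<omega>. \<alpha> / (2 * real DIM('a)) * ((norm (gradient f (iterate (dirs \<omega>) t)))\<^sup>2 - L\<^sup>2 * \<alpha>\<^sup>2))"
    using integrable_gradient_square[of t] assms by (simp add: mean_square_gradient_def prob_space)
  also have "\<dots> \<le> expectation (\<lambda>\<omega>. \<integral>y. \<Phi> (history t (dirs \<omega>), y) \<partial>uniform_sphere)"
  proof (rule integral_mono)
    show "integrable M (\<lambda>\<omega>. \<alpha> / (2 * real DIM('a)) * ((norm (gradient f (iterate (dirs \<omega>) t)))\<^sup>2 - L\<^sup>2 * \<alpha>\<^sup>2))"
      using integrable_gradient_square[of t] assms by simp
  qed (use cond(1) pointwise in \<open>auto simp: history_def\<close>)
  finally show ?thesis
    using cond(2) by simp
qed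

lemma mean_residual_recursion:
  assumes "Suc t \<le> T"
  shows "mean_square_residual (Suc t) \<le> 12 * L\<^sup>2 * \<alpha> ^ 4 + mean_square_residual t / 4
    + 3 * \<alpha>\<^sup>2 / real DIM('a) * (mean_square_gradient (Suc t) + mean_square_gradient t)"
proof -
  let ?s = "\<lambda>t \<omega>. (dirs \<omega> t \<bullet> gradient f (iterate (dirs \<omega>) t))\<^sup>2"
  have "mean_square_residual (Suc t) \<le> expectation (\<lambda>\<omega>. 12 * L\<^sup>2 * \<alpha> ^ 4 + (residual (dirs \<omega>) t)\<^sup>2 / 4
      + 3 * \<alpha>\<^sup>2 * (?s (Suc t) \<omega> + ?s t \<omega>))"
    unfolding mean_square_residual_def
  proof (rule integral_mono_AE)
    show "AE \<omega> in M. (residual (dirs \<omega>) (Suc t))\<^sup>2 \<le> 12 * L\<^sup>2 * \<alpha> ^ 4 + (residual (dirs \<omega>) t)\<^sup>2 / 4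
        + 3 * \<alpha>\<^sup>2 * (?s (Suc t) \<omega> + ?s t \<omega>)"
      using AE_norm_dirs
    proof eventually_elim
      case (elim \<omega>)
      then show ?case using assms by (intro residual_square_recursion) auto
    qed
  qed (use assms in \<open>auto intro!: integrable_residual_square integrable_slope_square
      Bochner_Integration.integrable_add integrable_mult_right\<close>)
  also have "\<dots> = 12 * L\<^sup>2 * \<alpha> ^ 4 + mean_square_residual t / 4
      + 3 * \<alpha>\<^sup>2 * (expectation (?s (Suc t)) + expectation (?s t))"
    using assms by (simp add: integrable_residual_square integrable_slope_square prob_space
        mean_square_residual_def)
  also have "expectation (?s (Suc t)) + expectation (?s t)
      = (mean_square_gradient (Suc t) + mean_square_gradient t) / real DIM('a)"
    using assms by (simp add: mean_slope_square add_divide_distrib)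
  finally show ?thesis by simp
qed

lemma mean_descent:
  assumes "1 \<le> t" "t \<le> T"
  shows "expectation (\<lambda>\<omega>. f (iterate (dirs \<omega>) (Suc t)))
    \<le> expectation (\<lambda>\<omega>. f (iterate (dirs \<omega>) t))
      - \<alpha> / (8 * real DIM('a) * L0) * (mean_square_gradient t - L\<^sup>2 * \<alpha>\<^sup>2)
      + L / (32 * L0\<^sup>2) * mean_square_residual t"
proof -
  let ?s = "\<lambda>\<omega>. residual (dirs \<omega>) t * (dirs \<omega> t \<bullet> gradient f (iterate (dirs \<omega>) t))"
  have "expectation (\<lambda>\<omega>. f (iterate (dirs \<omega>) (Suc t)))
      \<le> expectation (\<lambda>\<omega>. f (iterate (dirs \<omega>) t) - ?s \<omega> / (4 * L0)
          + L / (32 * L0\<^sup>2) * (residual (dirs \<omega>) t)\<^sup>2)"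
  proof (rule integral_mono_AE)
    show "AE \<omega> in M. f (iterate (dirs \<omega>) (Suc t)) \<le> f (iterate (dirs \<omega>) t) - ?s \<omega> / (4 * L0)
        + L / (32 * L0\<^sup>2) * (residual (dirs \<omega>) t)\<^sup>2"
      using AE_norm_dirs
    proof eventually_elim
      case (elim \<omega>)
      then show ?case using assms by (intro descent_step) auto
    qed
  qed (use assms in \<open>auto intro!: integrable_residual_square integrable_residual_slope
      integrable_f_iterate Bochner_Integration.integrable_add Bochner_Integration.integrable_diff
      integrable_mult_right\<close>)
  also have "\<dots> = expectation (\<lambda>\<omega>. f (iterate (dirs \<omega>) t)) - expectation ?s / (4 * L0)
      + L / (32 * L0\<^sup>2) * mean_square_residual t"
    using assms by (simp add: integrable_residual_square integrable_residual_slope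
        integrable_f_iterate mean_square_residual_def)
  also have "\<dots> \<le> expectation (\<lambda>\<omega>. f (iterate (dirs \<omega>) t))
      - (\<alpha> / (2 * real DIM('a)) * (mean_square_gradient t - L\<^sup>2 * \<alpha>\<^sup>2)) / (4 * L0)
      + L / (32 * L0\<^sup>2) * mean_square_residual t"
    using mean_drift_lower_bound[OF assms] L0_pos
    by (intro add_mono diff_mono divide_right_mono) auto
  finally show ?thesis by simp
qed

lemma mean_square_gradient_1: "mean_square_gradient 1 = (norm (gradient f x1))\<^sup>2"
  by (simp add: mean_square_gradient_def prob_space)

lemma mean_square_gradient_0: "mean_square_gradient 0 = mean_square_gradient 1"
  by (simp add: mean_square_gradient_def)

lemma mean_square_gradient_nonneg: "mean_square_gradient t \<ge> 0"
  by (simp add: mean_square_gradient_def)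

lemma mean_square_residual_nonneg: "mean_square_residual t \<ge> 0"
  by (simp add: mean_square_residual_def)

text \<open>
  The recursion is summed with its contraction factor \<open>1 / 4\<close>, so that only \<open>3 / 4\<close> of the sum remains on
  the left. Keeping the last residual and the last gradient in the induction hypothesis makes the
  step an exact telescoping.
\<close>

lemma sum_mean_square_residual:
  "(\<Sum>t=1..T. mean_square_residual t)
    \<le> 16 * L\<^sup>2 * \<alpha> ^ 4 * real T
      + 4 * \<alpha>\<^sup>2 / real DIM('a) * (2 * (\<Sum>t=1..T. mean_square_gradient t) + mean_square_gradient 1)"
proof -
  define K where "K = 3 * \<alpha>\<^sup>2 / real DIM('a)"
  have "K \<ge> 0" by (simp add: K_def)
  have "3 / 4 * (\<Sum>t=1..k. mean_square_residual t) + mean_square_residual k / 4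
      \<le> 12 * L\<^sup>2 * \<alpha> ^ 4 * real k
        + K * (2 * (\<Sum>t=1..k. mean_square_gradient t) + mean_square_gradient 1 - mean_square_gradient k)"
    if "k \<le> T" for k
    using that
  proof (induction k)
    case 0
    then show ?case
      by (simp add: mean_square_gradient_0 mean_square_residual_def)
  next
    case (Suc k)
    then show ?case
      using mean_residual_recursion[of k, folded K_def] by (simp add: algebra_simps)
  qed
  from this[of T] have "3 / 4 * (\<Sum>t=1..T. mean_square_residual t)
      \<le> 12 * L\<^sup>2 * \<alpha> ^ 4 * real T
        + K * (2 * (\<Sum>t=1..T. mean_square_gradient t) + mean_square_gradient 1)"
    using mean_square_residual_nonneg[of T] mult_nonneg_nonneg[OF \<open>K \<ge> 0\<close> mean_square_gradient_nonneg[of T]]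
    by (simp add: algebra_simps)
  then have "4 / 3 * (3 / 4 * (\<Sum>t=1..T. mean_square_residual t))
      \<le> 4 / 3 * (12 * L\<^sup>2 * \<alpha> ^ 4 * real T
        + K * (2 * (\<Sum>t=1..T. mean_square_gradient t) + mean_square_gradient 1))"
    by (rule mult_left_mono) simp
  then show ?thesis
    by (simp add: K_def distrib_left mult_ac)
qed

lemma sum_mean_descent:
  assumes lb: "\<And>y. m \<le> f y"
  shows "\<alpha> / (8 * real DIM('a) * L0) * ((\<Sum>t=1..T. mean_square_gradient t) - real T * (L\<^sup>2 * \<alpha>\<^sup>2))
    \<le> f x1 - m + L / (32 * L0\<^sup>2) * (\<Sum>t=1..T. mean_square_residual t)"
proof -
  define K where "K = \<alpha> / (8 * real DIM('a) * L0)"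
  have "expectation (\<lambda>\<omega>. f (iterate (dirs \<omega>) (Suc k)))
      \<le> f x1 - K * ((\<Sum>t=1..k. mean_square_gradient t) - real k * (L\<^sup>2 * \<alpha>\<^sup>2))
        + L / (32 * L0\<^sup>2) * (\<Sum>t=1..k. mean_square_residual t)"
    if "k \<le> T" for k
    using that
  proof (induction k)
    case 0
    then show ?case by (simp add: prob_space)
  next
    case (Suc k)
    then show ?case
      using mean_descent[of "Suc k", folded K_def] by (simp add: algebra_simps)
  qed
  from this[of T] have "expectation (\<lambda>\<omega>. f (iterate (dirs \<omega>) (Suc T)))
      \<le> f x1 - K * ((\<Sum>t=1..T. mean_square_gradient t) - real T * (L\<^sup>2 * \<alpha>\<^sup>2))
        + L / (32 * L0\<^sup>2) * (\<Sum>t=1..T. mean_square_residual t)"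
    by simp
  moreover have "m \<le> expectation (\<lambda>\<omega>. f (iterate (dirs \<omega>) (Suc T)))"
  proof -
    have "expectation (\<lambda>\<omega>. m) \<le> expectation (\<lambda>\<omega>. f (iterate (dirs \<omega>) (Suc T)))"
      by (intro integral_mono integrable_f_iterate) (auto simp: lb)
    then show ?thesis by (simp add: prob_space)
  qed
  ultimately show ?thesis
    unfolding K_def by linarith
qed

text \<open>
  In the abbreviations of the proof, dividing the summed descent inequality by its coefficient turns
  the initial gap into \<open>8 * A\<close>, by the choice of \<open>\<alpha>\<close>, and gives \<open>S \<le> 9 * A + L * d / (4 * L0 * \<alpha>) * R\<close>. The
  bound on the residuals makes the last term at most \<open>4 * (d * q) * A + q * (2 * S + N)\<close>, where \<open>N\<close> is
  the squared gradient norm at \<open>x1\<close>. As \<open>d * q \<le> 1 / 4\<close>, this is at most \<open>A + S / 2 + N / 4\<close>, and \<open>N \<le> A / 2\<close> because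
  \<open>f\<close> is bounded below. Solving for \<open>S\<close> yields the factor \<open>2 * (9 + 1 + 1 / 8) = 81 / 4\<close>.
\<close>

lemma sum_mean_square_gradient_le:
  assumes lb: "\<And>y. m \<le> f y"
    and small: "4 * real DIM('a) * L * \<alpha> \<le> L0"
    and \<alpha>_cubed: "real DIM('a) * L0 * (f x1 - m) = L\<^sup>2 * real T * \<alpha> ^ 3"
  shows "(\<Sum>t=1..T. mean_square_gradient t) \<le> 81 / 4 * (real T * (L\<^sup>2 * \<alpha>\<^sup>2))"
proof -
  define d where "d = real DIM('a)"
  define S where "S = (\<Sum>t=1..T. mean_square_gradient t)"
  define R where "R = (\<Sum>t=1..T. mean_square_residual t)"
  define A where "A = real T * (L\<^sup>2 * \<alpha>\<^sup>2)"
  define q where "q = L * \<alpha> / L0"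
  have d: "d \<ge> 1" by (simp add: d_def Suc_leI)
  have nonneg: "S \<ge> 0" "A \<ge> 0" "mean_square_gradient 1 \<ge> 0" "q \<ge> 0"
    using L_pos L0_pos \<alpha>_pos
    by (auto simp: S_def A_def q_def intro!: sum_nonneg mean_square_gradient_nonneg)
  have dq: "d * q \<le> 1 / 4"
    using small L0_pos by (simp add: q_def d_def field_simps)
  have q: "q \<le> 1 / 4"
    using dq mult_right_mono[OF d \<open>q \<ge> 0\<close>] by linarith
  have \<Delta>: "f x1 - m = A * \<alpha> / (d * L0)"
    using \<alpha>_cubed d L0_pos
    by (simp add: A_def d_def[symmetric] field_simps power2_eq_square power3_eq_cube)

  have "mean_square_gradient 1 \<le> 2 * L * (f x1 - m)"
    unfolding mean_square_gradient_1 by (rule smooth_with_lower_bound_gradient[OF smooth L_pos lb])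
  also have "\<dots> = 2 * (q / d) * A"
    by (simp add: \<Delta> q_def mult_ac)
  also have "\<dots> \<le> 2 * (1 / 4) * A"
  proof -
    have "q / d \<le> q / 1" using d nonneg by (intro divide_left_mono) auto
    then have "q / d \<le> 1 / 4" using q by linarith
    then show ?thesis using nonneg by (intro mult_right_mono mult_left_mono) auto
  qed
  finally have first: "mean_square_gradient 1 \<le> A / 2" by simp

  have scale: "8 * d * L0 / \<alpha> * (\<alpha> / (8 * d * L0) * x) = x" for x
    using d L0_pos \<alpha>_pos by simp
  have "8 * d * L0 / \<alpha> * (\<alpha> / (8 * d * L0) * (S - A))
      \<le> 8 * d * L0 / \<alpha> * (f x1 - m + L / (32 * L0\<^sup>2) * R)"
    using sum_mean_descent[OF lb] d L0_pos \<alpha>_pos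
    by (intro mult_left_mono) (auto simp: S_def A_def R_def d_def)
  then have "S - A \<le> 8 * d * L0 / \<alpha> * (f x1 - m + L / (32 * L0\<^sup>2) * R)"
    unfolding scale .
  also have "\<dots> = 8 * A + L * d / (4 * L0 * \<alpha>) * R"
    using d L0_pos \<alpha>_pos by (simp add: \<Delta> field_simps power2_eq_square)
  finally have descent: "S - A \<le> 8 * A + L * d / (4 * L0 * \<alpha>) * R" .
  have "L * d / (4 * L0 * \<alpha>) * R
      \<le> L * d / (4 * L0 * \<alpha>)
        * (16 * L\<^sup>2 * \<alpha> ^ 4 * real T + 4 * \<alpha>\<^sup>2 / d * (2 * S + mean_square_gradient 1))"
    using sum_mean_square_residual d L0_pos L_pos \<alpha>_pos
    by (intro mult_left_mono) (auto simp: S_def R_def d_def)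
  also have "\<dots> = 4 * (d * q) * A + q * (2 * S + mean_square_gradient 1)"
    using d L0_pos \<alpha>_pos
    by (simp add: q_def A_def field_simps power2_eq_square power4_eq_xxxx)
  also have "\<dots> \<le> 4 * (1 / 4) * A + 1 / 4 * (2 * S + mean_square_gradient 1)"
    using dq q nonneg by (intro add_mono mult_right_mono mult_left_mono) auto
  finally have "S - A \<le> 8 * A + (4 * (1 / 4) * A + 1 / 4 * (2 * S + mean_square_gradient 1))"
    by (intro order_trans[OF descent] add_left_mono)
  then have "S \<le> 81 / 4 * A"
    using first by argo
  then show ?thesis
    by (simp only: S_def A_def)
qed

end

section \<open>The sample complexity\<close>

lemma power3_le_imp_le:
  fixes a b :: real
  assumes "a ^ 3 \<le> b ^ 3" "0 \<le> b"
  shows "a \<le> b"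
  using power_le_imp_le_base[of a 2 b] assms by simp

theorem corollary10:
  fixes f :: "'a::euclidean_space \<Rightarrow> real"
    and x1 xs :: 'a
    and L0 L \<eta> \<alpha> \<epsilon> d \<Delta> :: real
    and T :: nat
    and M :: "'b measure"
    and u :: "nat \<Rightarrow> 'b \<Rightarrow> 'a"
  defines "d \<equiv> real DIM('a)"
    and "\<Delta> \<equiv> f x1 - f xs"
  assumes "L0 > 0" and "L > 0" and "\<epsilon> > 0"
    and "L0-lipschitz_on UNIV f"
    and "smooth_with L f"
    and "\<And>y. f xs \<le> f y"
    and "prob_space M"
    and "prob_space.indep_vars M (\<lambda>_. borel) u {0..T}"
    and "\<And>t. t \<in> {0..T} \<Longrightarrow> distr M borel (u t) = uniform_sphere"
    and "\<eta> > 0" and "\<alpha> > 0"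
    and "\<eta> = \<alpha> / (4 * d * L0)"
    and "\<alpha> = (d * L0 * \<Delta> / (L\<^sup>2 * real T)) powr (1/3)"
    and "real T \<ge> Max {6 powr (3/2) * d * L0 / (\<Delta> powr (1/2) * L powr (1/2)),
                       5 ^ 3 * d ^ 4 * \<Delta> / (L\<^sup>2 * L0\<^sup>2),
                       4 ^ 3 * L * d ^ 4 * \<Delta> / L0\<^sup>2}"
    and "real T \<ge> 24 powr (3/2) * d * L0 * L * \<Delta> / \<epsilon> ^ 3"
  shows "1 / real T * (\<Sum>t = 1..T. prob_space.expectation M
           (\<lambda>\<omega>. (norm (gradient f (residual_iterate f \<eta> \<alpha> x1 (\<lambda>s. u s \<omega>) t)))\<^sup>2)) \<le> \<epsilon>\<^sup>2"
proof -
  have d: "d \<ge> 1" by (simp add: d_def Suc_leI)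
  \<comment> \<open>A positive \<open>\<alpha>\<close> rules out \<open>T = 0\<close> and a vanishing initial gap: either would make the base of \<open>powr\<close> zero.\<close>
  have "d * L0 * \<Delta> / (L\<^sup>2 * real T) \<noteq> 0"
    using assms by force
  then have T: "real T > 0" and "\<Delta> \<noteq> 0"
    by auto
  then have \<Delta>: "\<Delta> > 0"
    using assms(8)[of x1] by (simp add: \<Delta>_def)
  have "\<alpha> ^ 3 = \<alpha> powr 3"
    using \<open>\<alpha> > 0\<close> by (simp add: powr_realpow)
  also have "\<dots> = d * L0 * \<Delta> / (L\<^sup>2 * real T)"
    unfolding \<open>\<alpha> = _\<close> using d \<Delta> T assms(3,4) by (simp add: powr_powr)
  finally have cube: "\<alpha> ^ 3 = d * L0 * \<Delta> / (L\<^sup>2 * real T)" .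

  \<comment> \<open>The lower bound on \<open>T\<close> that involves \<open>L * d ^ 4\<close> says exactly that \<open>4 * d * L * \<alpha> \<le> L0\<close>.\<close>
  have "4 ^ 3 * L * d ^ 4 * \<Delta> / L0\<^sup>2 \<le> real T"
    using assms by simp
  then have "4 ^ 3 * L * d ^ 4 * \<Delta> / L0\<^sup>2 / real T \<le> 1"
    using T by (simp only: divide_le_eq_1_pos)
  then have le: "4 ^ 3 * L * d ^ 4 * \<Delta> / L0\<^sup>2 / real T * L0 ^ 3 \<le> 1 * L0 ^ 3"
    using assms(3) by (intro mult_right_mono) auto
  have eq: "(4 * d * L * \<alpha>) ^ 3 = 4 ^ 3 * L * d ^ 4 * \<Delta> / L0\<^sup>2 / real T * L0 ^ 3"
  proof -
    have "(4 * d * L * \<alpha>) ^ 3 = 4 ^ 3 * d ^ 3 * L ^ 3 * (d * L0 * \<Delta> / (L\<^sup>2 * real T))"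
      by (simp only: power_mult_distrib cube)
    also have "\<dots> = 4 ^ 3 * d ^ 3 * (L * L\<^sup>2) * (d * L0 * \<Delta> / (L\<^sup>2 * real T))"
      by (simp add: power2_eq_square power3_eq_cube)
    also have "\<dots> = 4 ^ 3 * L * (d * d ^ 3) * \<Delta> / L0\<^sup>2 / real T * (L0 * L0\<^sup>2)"
      using assms(3,4) by simp
    also have "d * d ^ 3 = d ^ 4"
      by (simp add: power3_eq_cube power4_eq_xxxx)
    also have "L0 * L0\<^sup>2 = L0 ^ 3"
      by (simp add: power2_eq_square power3_eq_cube)
    finally show ?thesis .
  qed
  have "(4 * d * L * \<alpha>) ^ 3 \<le> L0 ^ 3"
    using le unfolding eq mult_1 .
  then have small: "4 * d * L * \<alpha> \<le> L0"
    by (rule power3_le_imp_le) (use assms(3) in simp)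

  \<comment> \<open>By the choice of \<open>\<alpha>\<close>, the required sample complexity says exactly that \<open>24 * (L * \<alpha>)\<^sup>2 \<le> \<epsilon>\<^sup>2\<close>.\<close>
  have cost: "24 powr (3/2) * (d * L0 * L * \<Delta>) \<le> real T * \<epsilon> ^ 3"
    using assms(5,17) by (simp add: field_simps)
  have cubeL: "(L * \<alpha>) ^ 3 = d * L0 * L * \<Delta> / real T"
  proof -
    have "(L * \<alpha>) ^ 3 = L ^ 3 * (d * L0 * \<Delta> / (L\<^sup>2 * real T))"
      by (simp only: power_mult_distrib cube)
    also have "\<dots> = L * L\<^sup>2 * (d * L0 * \<Delta> / (L\<^sup>2 * real T))"
      by (simp add: power2_eq_square power3_eq_cube)
    also have "\<dots> = d * L0 * L * \<Delta> / real T"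
      using assms(4) by simp
    finally show ?thesis .
  qed
  have root: "24 powr (3/2) = sqrt 24 ^ 3"
    by (simp add: powr_half_sqrt[symmetric] powr_power)
  have "(sqrt 24 * (L * \<alpha>)) ^ 3 = 24 powr (3/2) * (d * L0 * L * \<Delta>) / real T"
    by (simp only: power_mult_distrib[of "sqrt 24"] cubeL root times_divide_eq_right)
  also have "\<dots> \<le> \<epsilon> ^ 3"
    using cost T by (simp add: divide_le_eq mult.commute)
  finally have "(sqrt 24 * (L * \<alpha>)) ^ 3 \<le> \<epsilon> ^ 3" .
  then have "sqrt 24 * (L * \<alpha>) \<le> \<epsilon>"
    by (rule power3_le_imp_le) (use assms(5) in simp)
  then have "(sqrt 24 * (L * \<alpha>))\<^sup>2 \<le> \<epsilon>\<^sup>2"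
    using assms(4,13) by (intro power_mono) auto
  then have \<epsilon>: "24 * (L\<^sup>2 * \<alpha>\<^sup>2) \<le> \<epsilon>\<^sup>2"
    by (simp add: power_mult_distrib)

  interpret prob_space M by fact
  interpret residual_feedback_run f L0 L \<alpha> x1 M u T
    by unfold_locales (use assms in auto)
  have "(\<Sum>t = 1..T. mean_square_gradient t) \<le> 81 / 4 * (real T * (L\<^sup>2 * \<alpha>\<^sup>2))"
  proof (rule sum_mean_square_gradient_le)
    show "f xs \<le> f y" for y by fact
    show "4 * real DIM('a) * L * \<alpha> \<le> L0"
      using small by (simp add: d_def)
    show "real DIM('a) * L0 * (f x1 - f xs) = L\<^sup>2 * real T * \<alpha> ^ 3"
      unfolding cube using T assms(4) by (simp add: d_def \<Delta>_def)
  qed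
  then have "1 / real T * (\<Sum>t = 1..T. mean_square_gradient t) \<le> 81 / 4 * (L\<^sup>2 * \<alpha>\<^sup>2)"
    using T by (simp add: field_simps)
  also have "\<dots> \<le> 24 * (L\<^sup>2 * \<alpha>\<^sup>2)"
    by (intro mult_right_mono) auto
  also note \<epsilon>
  finally show ?thesis
    unfolding mean_square_gradient_def iterate_def dirs_def[abs_def] \<open>\<eta> = _\<close> d_def .
qed

end
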